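(* Let $(M,g)$ be a Riemannian manifold, let $\lambda_i\in\mathbb{C}$ and $A_{ij}\in\mathbb{C}$ for $i,j\in\{1,\dots,k\}$, and let $\{\phi_1,\dots,\phi_k\}$ be a $(\lambda_i,A_{ij})$-eigenfamily on $(M,g)$. Let $d_1,\dots,d_k\in\mathbb{C}$, let $U\subseteq\mathbb{C}^k$ be open and let $F:U\to\mathbb{C}$ be holomorphic with $$F(t_1z_1,\dots,t_kz_k)=\Big(\prod_{i=1}^k t_i^{d_i}\Big)F(z_1,\dots,z_k)$$ for all $(z_1,\dots,z_k)\in U$ and all $t_1,\dots,t_k\in\mathbb{R}$ close enough to $1$. Then the map $$(\phi_1,\dots,\phi_k)^{-1}(U)\to\mathbb{C},\qquad x\mapsto F(\phi_1(x),\dots,\phi_k(x))$$ is a $(\widetilde\lambda,\widetilde\mu)$-eigenfunction on the open subset $(\phi_1,\dots,\phi_k)^{-1}(U)$ of $M$, where $$\widetilde\lambda=\sum_{i}d_i(\lambda_i-A_{ii})+\sum_{i,j}d_id_jA_{ij},\qquad \widetilde\mu=\sum_{i,j}d_id_jA_{ij}.$$ In particular, if $$\sum_{i,j}d_id_jA_{ij}=0\quad\text{and}\quad \sum_i d_i(\lambda_i-A_{ii})=0,$$ then this map is a harmonic morphism.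
   Context: For a Riemannian manifold $(M,g)$, extend $g$ complex bilinearly to the complexified tangent bundle. For smooth functions $\phi,\psi:M\to\mathbb{C}$ let $\tau(\phi)=\operatorname{div}(\nabla\phi)$ be the (complex linear) Laplace-Beltrami operator and $\kappa(\phi,\psi)=g(\nabla\phi,\nabla\psi)$ (complex bilinear, no conjugation). For $\lambda,\mu\in\mathbb{C}$, a function $\phi$ is a $(\lambda,\mu)$-eigenfunction if $\tau(\phi)=\lambda\phi$ and $\kappa(\phi,\phi)=\mu\phi^2$. Given $\lambda_i,A_{ij}\in\mathbb{C}$ for $i,j\in\{1,\dots,k\}$, a finite family $\{\phi_1,\dots,\phi_k\}$ of smooth functions $M\to\mathbb{C}$ is a $(\lambda_i,A_{ij})$-eigenfamily if $\tau(\phi_i)=\lambda_i\phi_i$ and $\kappa(\phi_i,\phi_j)=A_{ij}\,\phi_i\phi_j$ for all $i,j\in\{1,\dots,k\}$. For $t>0$ and $d\in\mathbb{C}$, $t^d=e^{d\ln t}$; "close enough to $1$" means that for each $z\in U$ there is a neighbourhood of $1$ in $\mathbb{R}_{>0}$ such that $(t_1z_1,\dots,t_kz_k)\in U$ and the identity holds for all $t_i$ in it. A smooth complex-valued function $\phi$ on a Riemannian manifold is a harmonic morphism (with codomain $\mathbb{C}$) if and only if $\tau(\phi)=0$ and $\kappa(\phi,\phi)=0$, i.e. it is a $(0,0)$-eigenfunction. *)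

theory Defs
  imports "HOL-Analysis.Analysis"
begin

section \<open>Smooth and holomorphic functions on open sets\<close>

text \<open>\<open>Ck_on n S f\<close> is meant for open \<open>S\<close>: the iterated directional derivatives of \<open>f\<close>
  up to order \<open>n\<close> exist and are continuous on \<open>S\<close>.\<close>

primrec Ck_on ::
  "nat \<Rightarrow> 'e::euclidean_space set \<Rightarrow> ('e \<Rightarrow> 'b::real_normed_vector) \<Rightarrow> bool" where
  "Ck_on 0 S f \<longleftrightarrow> continuous_on S f"
| "Ck_on (Suc n) S f \<longleftrightarrow> (\<forall>x\<in>S. f differentiable at x) \<and>
     (\<forall>v. Ck_on n S (\<lambda>x. frechet_derivative f (at x) v))"

definition smooth_on :: "'e::euclidean_space set \<Rightarrow> ('e \<Rightarrow> 'b::real_normed_vector) \<Rightarrow> bool" where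
  "smooth_on S f \<longleftrightarrow> (\<forall>n. Ck_on n S f)"

text \<open>Holomorphy in several variables: complex (Frechet) differentiability at each point.\<close>

definition holomorphic_several_on ::
  "(complex ^ 'k::finite \<Rightarrow> complex) \<Rightarrow> (complex ^ 'k) set \<Rightarrow> bool" where
  "holomorphic_several_on F U \<longleftrightarrow>
     (\<forall>z\<in>U. \<exists>F'. (F has_derivative F') (at z) \<and> (\<forall>c v. F' (c *s v) = c * F' v))"

section \<open>Riemannian manifolds\<close>

text \<open>A chart is an open domain together with a coordinate map, of which only the values
  on the domain matter.\<close>

type_synonym ('a, 'm) chart = "'a set \<times> ('a \<Rightarrow> real ^ 'm)"

definition cdom :: "('a, 'm::finite) chart \<Rightarrow> 'a set" where
  "cdom c = fst c"

definition coord :: "('a, 'm::finite) chart \<Rightarrow> 'a \<Rightarrow> real ^ 'm" where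
  "coord c = snd c"

definition param :: "('a, 'm::finite) chart \<Rightarrow> real ^ 'm \<Rightarrow> 'a" where
  "param c = inv_into (cdom c) (coord c)"

locale smooth_manifold =
  fixes X :: "'a topology" and Atl :: "('a, 'm::finite) chart set"
  assumes hausdorff: "Hausdorff_space X"
    and countable_base: "second_countable X"
    and chart_open: "c \<in> Atl \<Longrightarrow> openin X (cdom c)"
    and chart_image_open: "c \<in> Atl \<Longrightarrow> open (coord c ` cdom c)"
    and chart_homeo: "c \<in> Atl \<Longrightarrow>
      homeomorphic_map (subtopology X (cdom c)) (top_of_set (coord c ` cdom c)) (coord c)"
    and charts_cover: "(\<Union>c\<in>Atl. cdom c) = topspace X"
    and transition_smooth: "c \<in> Atl \<Longrightarrow> c' \<in> Atl \<Longrightarrow>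
      smooth_on (coord c ` (cdom c \<inter> cdom c')) (coord c' \<circ> param c)"

text \<open>The metric is given by its component matrices: \<open>g c p $ i $ j\<close> is the inner product at \<open>p\<close>
  of the \<open>i\<close>-th and \<open>j\<close>-th coordinate vectors of the chart \<open>c\<close>.  The last axiom is the
  transformation law of a covariant 2-tensor.\<close>

locale riemannian_manifold = smooth_manifold X Atl
  for X :: "'a topology" and Atl :: "('a, 'm::finite) chart set" +
  fixes g :: "('a, 'm) chart \<Rightarrow> 'a \<Rightarrow> real ^ 'm ^ 'm"
  assumes metric_symmetric: "c \<in> Atl \<Longrightarrow> p \<in> cdom c \<Longrightarrow> transpose (g c p) = g c p"
    and metric_positive: "c \<in> Atl \<Longrightarrow> p \<in> cdom c \<Longrightarrow> v \<noteq> 0 \<Longrightarrow> v \<bullet> (g c p *v v) > 0"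
    and metric_smooth: "c \<in> Atl \<Longrightarrow> smooth_on (coord c ` cdom c) (g c \<circ> param c)"
    and metric_tensorial: "c \<in> Atl \<Longrightarrow> c' \<in> Atl \<Longrightarrow> p \<in> cdom c \<inter> cdom c' \<Longrightarrow>
      J = jacobian (coord c' \<circ> param c) (at (coord c p)) \<Longrightarrow>
      g c p = transpose J ** g c' p ** J"

definition smooth_fun_on :: "'a topology \<Rightarrow> ('a, 'm::finite) chart set \<Rightarrow> 'a set \<Rightarrow>
    ('a \<Rightarrow> 'b::real_normed_vector) \<Rightarrow> bool" where
  "smooth_fun_on X Atl V f \<longleftrightarrow> openin X V \<and>
     (\<forall>c\<in>Atl. smooth_on (coord c ` (cdom c \<inter> V)) (f \<circ> param c))"

section \<open>Gradient, divergence, Laplace-Beltrami operator and conformality operator\<close>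

definition pdiff :: "('a, 'm::finite) chart \<Rightarrow> 'm \<Rightarrow> ('a \<Rightarrow> complex) \<Rightarrow> 'a \<Rightarrow> complex" where
  "pdiff c i f p = frechet_derivative (f \<circ> param c) (at (coord c p)) (axis i 1)"

text \<open>Complex vector fields are represented in a chart by their components with respect to
  the coordinate frame; everything is extended complex (bi)linearly.\<close>

definition grad :: "(('a, 'm::finite) chart \<Rightarrow> 'a \<Rightarrow> real ^ 'm ^ 'm) \<Rightarrow> ('a, 'm) chart \<Rightarrow>
    ('a \<Rightarrow> complex) \<Rightarrow> 'a \<Rightarrow> complex ^ 'm" where
  "grad g c f p = (\<chi> i. \<Sum>j\<in>UNIV. complex_of_real (matrix_inv (g c p) $ i $ j) * pdiff c j f p)"

definition divergence :: "(('a, 'm::finite) chart \<Rightarrow> 'a \<Rightarrow> real ^ 'm ^ 'm) \<Rightarrow> ('a, 'm) chart \<Rightarrow>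
    ('a \<Rightarrow> complex ^ 'm) \<Rightarrow> 'a \<Rightarrow> complex" where
  "divergence g c Y p =
     (\<Sum>i\<in>UNIV. pdiff c i (\<lambda>q. complex_of_real (sqrt (det (g c q))) * Y q $ i) p)
       / complex_of_real (sqrt (det (g c p)))"

definition metric_bilinear :: "(('a, 'm::finite) chart \<Rightarrow> 'a \<Rightarrow> real ^ 'm ^ 'm) \<Rightarrow>
    ('a, 'm) chart \<Rightarrow> 'a \<Rightarrow> complex ^ 'm \<Rightarrow> complex ^ 'm \<Rightarrow> complex" where
  "metric_bilinear g c p v w =
     (\<Sum>i\<in>UNIV. \<Sum>j\<in>UNIV. complex_of_real (g c p $ i $ j) * v $ i * w $ j)"

text \<open>On a Riemannian manifold the two operators below do not depend on the chart around \<open>p\<close>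
  in which they are computed, so an arbitrary one is chosen.\<close>

definition chart_at :: "('a, 'm::finite) chart set \<Rightarrow> 'a \<Rightarrow> ('a, 'm) chart" where
  "chart_at Atl p = (SOME c. c \<in> Atl \<and> p \<in> cdom c)"

definition laplace_beltrami :: "('a, 'm::finite) chart set \<Rightarrow>
    (('a, 'm) chart \<Rightarrow> 'a \<Rightarrow> real ^ 'm ^ 'm) \<Rightarrow> ('a \<Rightarrow> complex) \<Rightarrow> 'a \<Rightarrow> complex" where
  "laplace_beltrami Atl g f p = (let c = chart_at Atl p in divergence g c (grad g c f) p)"

definition conformality :: "('a, 'm::finite) chart set \<Rightarrow>
    (('a, 'm) chart \<Rightarrow> 'a \<Rightarrow> real ^ 'm ^ 'm) \<Rightarrow> ('a \<Rightarrow> complex) \<Rightarrow> ('a \<Rightarrow> complex) \<Rightarrow> 'a \<Rightarrow> complex" where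
  "conformality Atl g f h p =
     (let c = chart_at Atl p in metric_bilinear g c p (grad g c f p) (grad g c h p))"

section \<open>Eigenfunctions, eigenfamilies and harmonic morphisms\<close>

definition eigenfunction_on :: "'a topology \<Rightarrow> ('a, 'm::finite) chart set \<Rightarrow>
    (('a, 'm) chart \<Rightarrow> 'a \<Rightarrow> real ^ 'm ^ 'm) \<Rightarrow> 'a set \<Rightarrow> complex \<Rightarrow> complex \<Rightarrow>
    ('a \<Rightarrow> complex) \<Rightarrow> bool" where
  "eigenfunction_on X Atl g V lam mu f \<longleftrightarrow> smooth_fun_on X Atl V f \<and>
     (\<forall>p\<in>V. laplace_beltrami Atl g f p = lam * f p) \<and>
     (\<forall>p\<in>V. conformality Atl g f f p = mu * (f p)\<^sup>2)"

definition eigenfamily_on :: "'a topology \<Rightarrow> ('a, 'm::finite) chart set \<Rightarrow>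
    (('a, 'm) chart \<Rightarrow> 'a \<Rightarrow> real ^ 'm ^ 'm) \<Rightarrow> 'a set \<Rightarrow> ('k::finite \<Rightarrow> complex) \<Rightarrow>
    ('k \<Rightarrow> 'k \<Rightarrow> complex) \<Rightarrow> ('k \<Rightarrow> 'a \<Rightarrow> complex) \<Rightarrow> bool" where
  "eigenfamily_on X Atl g V lam A \<phi> \<longleftrightarrow>
     (\<forall>i. smooth_fun_on X Atl V (\<phi> i)) \<and>
     (\<forall>i. \<forall>p\<in>V. laplace_beltrami Atl g (\<phi> i) p = lam i * \<phi> i p) \<and>
     (\<forall>i j. \<forall>p\<in>V. conformality Atl g (\<phi> i) (\<phi> j) p = A i j * \<phi> i p * \<phi> j p)"

definition harmonic_on :: "'a topology \<Rightarrow> ('a, 'm::finite) chart set \<Rightarrow>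
    (('a, 'm) chart \<Rightarrow> 'a \<Rightarrow> real ^ 'm ^ 'm) \<Rightarrow> 'a set \<Rightarrow> ('a \<Rightarrow> complex) \<Rightarrow> bool" where
  "harmonic_on X Atl g V f \<longleftrightarrow> smooth_fun_on X Atl V f \<and>
     (\<forall>p\<in>V. laplace_beltrami Atl g f p = 0)"

definition plane_harmonic_on :: "complex set \<Rightarrow> (complex \<Rightarrow> real) \<Rightarrow> bool" where
  "plane_harmonic_on W h \<longleftrightarrow> open W \<and> smooth_on W h \<and>
     (\<forall>z\<in>W. frechet_derivative (\<lambda>w. frechet_derivative h (at w) 1) (at z) 1 +
             frechet_derivative (\<lambda>w. frechet_derivative h (at w) \<i>) (at z) \<i> = 0)"

text \<open>A harmonic morphism is a smooth map pulling back local harmonic functions to local harmonic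
  functions.  By the theorem of Fuglede and Ishihara, those with values in \<open>\<complex>\<close> are exactly the
  eigenfunctions for the parameters \<open>(0, 0)\<close>.\<close>

definition harmonic_morphism_on :: "'a topology \<Rightarrow> ('a, 'm::finite) chart set \<Rightarrow>
    (('a, 'm) chart \<Rightarrow> 'a \<Rightarrow> real ^ 'm ^ 'm) \<Rightarrow> 'a set \<Rightarrow> ('a \<Rightarrow> complex) \<Rightarrow> bool" where
  "harmonic_morphism_on X Atl g V f \<longleftrightarrow> smooth_fun_on X Atl V f \<and>
     (\<forall>W h. plane_harmonic_on W h \<longrightarrow>
        harmonic_on X Atl g {p \<in> V. f p \<in> W} (\<lambda>p. complex_of_real (h (f p))))"

end

theory Submission
  imports Defs "HOL-Complex_Analysis.Cauchy_Integral_Formula"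
begin

text \<open>
  Differentiating the homogeneity relation in \<open>t\<^sub>a\<close> at \<open>1\<close> gives Euler's relation
  \<open>z\<^sub>a F\<^sub>a = d\<^sub>a F\<close> on \<open>U\<close>, and differentiating this once more gives
  \<open>z\<^sub>a z\<^sub>b F\<^sub>a\<^sub>b = d\<^sub>a d\<^sub>b F - \<delta>\<^sub>a\<^sub>b d\<^sub>a F\<close>. They turn the chain rules
  \<open>\<tau> (F \<circ> \<phi>) = \<Sum>\<^sub>a F\<^sub>a \<tau> (\<phi>\<^sub>a) + \<Sum>\<^sub>a\<^sub>b F\<^sub>a\<^sub>b \<kappa> (\<phi>\<^sub>a, \<phi>\<^sub>b)\<close> and
  \<open>\<kappa> (F \<circ> \<phi>, F \<circ> \<phi>) = \<Sum>\<^sub>a\<^sub>b F\<^sub>a F\<^sub>b \<kappa> (\<phi>\<^sub>a, \<phi>\<^sub>b)\<close> into the two eigenvalue equations. Since the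
  operators are evaluated in one chart, their independence of the chart is never needed.

  For a \<open>(0, 0)\<close>-eigenfunction \<open>u + \<i> v\<close> the equations say \<open>\<tau> (u) = \<tau> (v) = 0\<close>,
  \<open>\<kappa> (u, u) = \<kappa> (v, v)\<close> and \<open>\<kappa> (u, v) = 0\<close>, so that the real chain rule gives
  \<open>\<tau> (h \<circ> (u + \<i> v)) = (h\<^sub>x\<^sub>x + h\<^sub>y\<^sub>y) \<kappa> (u, u)\<close>.
\<close>

section \<open>Calculus of \<open>C\<^sup>k\<close> functions\<close>

lemma frechet_derivative_eq:
  "(f has_derivative f') (at x) \<Longrightarrow> frechet_derivative f (at x) = f'"
  by (rule frechet_derivative_at [symmetric])

text \<open>\<open>frechet_derivative\<close> is a choice from the predicate
  \<open>has_derivative\<close>. That predicate depends only on the germ at \<open>x\<close>, so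
  equal germs give the same choice, even where no derivative exists.\<close>

lemma frechet_derivative_cong_open:
  assumes "open S" "x \<in> S" "\<And>y. y \<in> S \<Longrightarrow> f y = h y"
  shows "frechet_derivative f (at x) = frechet_derivative h (at x)"
proof -
  have "(f has_derivative D) (at x) \<longleftrightarrow> (h has_derivative D) (at x)" for D
    using has_derivative_transform_within_open [of f D x UNIV S h]
      has_derivative_transform_within_open [of h D x UNIV S f] assms by auto
  then show ?thesis
    by (simp add: frechet_derivative_def)
qed

lemma differentiable_cong_open:
  assumes "open S" "x \<in> S" "\<And>y. y \<in> S \<Longrightarrow> f y = h y" "f differentiable at x"
  shows "h differentiable at x"
  using assms has_derivative_transform_within_open [of f _ x UNIV S h]
  unfolding differentiable_def by blast

lemma Ck_on_cong:
  assumes "open S" "\<And>x. x \<in> S \<Longrightarrow> f x = h x" "Ck_on n S f"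
  shows "Ck_on n S h"
  using assms(2,3)
proof (induction n arbitrary: f h)
  case 0
  then show ?case by (simp cong: continuous_on_cong)
next
  case (Suc n)
  have "h differentiable at x" if "x \<in> S" for x
    using differentiable_cong_open [of S x f h] assms(1) that Suc.prems by auto
  moreover have "Ck_on n S (\<lambda>x. frechet_derivative h (at x) v)" for v
  proof (rule Suc.IH)
    show "Ck_on n S (\<lambda>x. frechet_derivative f (at x) v)"
      using Suc.prems by simp
    show "frechet_derivative f (at x) v = frechet_derivative h (at x) v" if "x \<in> S" for x
      using frechet_derivative_cong_open [of S x f h] assms(1) that Suc.prems by simp
  qed
  ultimately show ?case by simp
qed

lemma Ck_on_subset: "Ck_on n S f \<Longrightarrow> T \<subseteq> S \<Longrightarrow> Ck_on n T f"
  by (induction n arbitrary: f) (auto intro: continuous_on_subset)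

lemma Ck_on_SucD: "Ck_on (Suc n) S f \<Longrightarrow> Ck_on n S f"
proof (induction n arbitrary: f)
  case 0
  then show ?case
    by (auto intro!: continuous_at_imp_continuous_on differentiable_imp_continuous_within)
qed auto

text \<open>Allows any explicit derivative formula in place of the chosen
  \<open>frechet_derivative\<close>; the closure properties below are inductions through this
  rule.\<close>

lemma Ck_on_SucI:
  assumes "open S" "\<And>x. x \<in> S \<Longrightarrow> (f has_derivative f' x) (at x)"
    "\<And>v. Ck_on n S (\<lambda>x. f' x v)"
  shows "Ck_on (Suc n) S f"
proof -
  have "Ck_on n S (\<lambda>x. frechet_derivative f (at x) v)" for v
    by (rule Ck_on_cong [OF assms(1) _ assms(3) [of v]])
       (simp add: frechet_derivative_eq [OF assms(2)])
  then show ?thesis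
    using assms(2) by (auto intro: differentiableI)
qed

lemma Ck_on_has_derivative:
  "Ck_on (Suc n) S f \<Longrightarrow> x \<in> S \<Longrightarrow> (f has_derivative frechet_derivative f (at x)) (at x)"
  by (simp add: frechet_derivative_works)

lemma Ck_on_const: "open S \<Longrightarrow> Ck_on n S (\<lambda>x. c)"
proof (induction n arbitrary: c)
  case (Suc n)
  show ?case
    by (rule Ck_on_SucI [where f' = "\<lambda>x v. 0"]) (use Suc in auto)
qed simp

lemma (in bounded_linear) Ck_on:
  assumes "open S" "Ck_on n S h"
  shows "Ck_on n S (\<lambda>x. f (h x))"
  using assms(2)
proof (induction n arbitrary: h)
  case 0
  then show ?case by (simp add: continuous_on)
next
  case (Suc n)
  show ?case
    by (rule Ck_on_SucI [OF assms(1) has_derivative [OF Ck_on_has_derivative [OF Suc.prems]]])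
       (use Suc in auto)
qed

lemma Ck_on_add:
  assumes "open S" "Ck_on n S f" "Ck_on n S h"
  shows "Ck_on n S (\<lambda>x. f x + h x)"
  using assms(2,3)
proof (induction n arbitrary: f h)
  case 0
  then show ?case by (simp add: continuous_on_add)
next
  case (Suc n)
  show ?case
    by (rule Ck_on_SucI [OF assms(1) has_derivative_add
          [OF Suc.prems(1) [THEN Ck_on_has_derivative] Suc.prems(2) [THEN Ck_on_has_derivative]]])
       (use Suc in auto)
qed

lemma Ck_on_sum:
  assumes "open S" "\<And>i. i \<in> I \<Longrightarrow> Ck_on n S (f i)"
  shows "Ck_on n S (\<lambda>x. \<Sum>i\<in>I. f i x)"
  using assms(2)
  by (induction I rule: infinite_finite_induct) (auto intro: Ck_on_const Ck_on_add assms(1))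

lemma (in bounded_bilinear) Ck_on:
  assumes "open S" "Ck_on n S f" "Ck_on n S h"
  shows "Ck_on n S (\<lambda>x. prod (f x) (h x))"
  using assms(2,3)
proof (induction n arbitrary: f h)
  case 0
  then show ?case by (simp add: continuous_on)
next
  case (Suc n)
  \<comment> \<open>The product rule pairs each derivative with an undifferentiated factor, so the
    factors are needed at order \<open>n\<close> as well.\<close>
  note prems = Suc.prems Suc.prems [THEN Ck_on_SucD]
  show ?case
    by (rule Ck_on_SucI [OF assms(1) FDERIV
          [OF Suc.prems(1) [THEN Ck_on_has_derivative] Suc.prems(2) [THEN Ck_on_has_derivative]]])
       (use prems in \<open>auto intro!: Ck_on_add assms(1) Suc.IH\<close>)
qed

lemma linear_eq_sum_Basis:
  fixes L :: "'e::euclidean_space \<Rightarrow> 'b::real_vector"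
  assumes "linear L"
  shows "L x = (\<Sum>b\<in>Basis. (x \<bullet> b) *\<^sub>R L b)"
  using linear_sum [OF assms, of "\<lambda>b. (x \<bullet> b) *\<^sub>R b" Basis]
  by (simp add: euclidean_representation linear_scale [OF assms])

text \<open>In the derivative \<open>?D x (?E x v)\<close> both the operator and its argument depend
  on \<open>x\<close>. Expanding the argument in \<open>Basis\<close> leaves a finite sum of
  products, each containing a directional derivative of \<open>F\<close> composed with
  \<open>\<Phi>\<close>. The induction therefore runs over all \<open>F\<close>.\<close>

lemma Ck_on_compose:
  fixes F :: "'e::euclidean_space \<Rightarrow> 'b::real_normed_vector"
  assumes "open S" "Ck_on n T F" "Ck_on n S \<Phi>" "\<Phi> ` S \<subseteq> T"
  shows "Ck_on n S (\<lambda>x. F (\<Phi> x))"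
  using assms(2,3)
proof (induction n arbitrary: F)
  case 0
  then show ?case
    using continuous_on_compose2 assms(4) by auto
next
  case (Suc n)
  let ?D = "\<lambda>x. frechet_derivative F (at (\<Phi> x))"
  let ?E = "\<lambda>x. frechet_derivative \<Phi> (at x)"
  have F: "(F has_derivative ?D x) (at (\<Phi> x))" if "x \<in> S" for x
    using assms(4) that by (intro Ck_on_has_derivative [OF Suc.prems(1)]) blast
  have eq: "(\<Sum>b\<in>Basis. (?E x v \<bullet> b) *\<^sub>R ?D x b) = ?D x (?E x v)" if "x \<in> S" for x v
    by (rule linear_eq_sum_Basis [OF has_derivative_linear [OF F [OF that]], symmetric])
  have "((\<lambda>x. F (\<Phi> x)) has_derivative (\<lambda>v. ?D x (?E x v))) (at x)" if "x \<in> S" for x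
    using diff_chain_at [OF Ck_on_has_derivative [OF Suc.prems(2) that] F [OF that]]
    by (simp add: o_def)
  moreover have "Ck_on n S (\<lambda>x. ?D x (?E x v))" for v
  proof (rule Ck_on_cong [OF assms(1)])
    show "Ck_on n S (\<lambda>x. \<Sum>b\<in>Basis. (?E x v \<bullet> b) *\<^sub>R ?D x b)"
      using Suc.prems(1) Suc.prems(2) Ck_on_SucD [OF Suc.prems(2)]
      by (auto intro!: Ck_on_sum assms(1) bounded_bilinear.Ck_on [OF bounded_bilinear_scaleR]
          bounded_linear.Ck_on [OF bounded_linear_inner_left] Suc.IH)
  qed (simp add: eq)
  ultimately show ?case
    by (rule Ck_on_SucI [OF assms(1)])
qed

section \<open>Holomorphic functions of several variables\<close>

lemma holomorphic_several_has_derivative: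
  "holomorphic_several_on F U \<Longrightarrow> z \<in> U \<Longrightarrow>
    (F has_derivative frechet_derivative F (at z)) (at z)"
  by (metis holomorphic_several_on_def frechet_derivative_eq)

lemma holomorphic_several_derivative_scale:
  "holomorphic_several_on F U \<Longrightarrow> z \<in> U \<Longrightarrow>
    frechet_derivative F (at z) (c *s v) = c * frechet_derivative F (at z) v"
  by (metis holomorphic_several_on_def frechet_derivative_eq)

section \<open>Complex lines and Cauchy's formula along them\<close>

lemma bounded_linear_vector_scalar_mult_left:
  "bounded_linear (\<lambda>c::complex. c *s (v :: complex ^ 'k::finite))"
proof -
  have "linear (\<lambda>c::complex. c *s v)"
    by (rule linearI) (auto simp: vec_eq_iff algebra_simps)
  then show ?thesis
    by (rule linear_conv_bounded_linear [THEN iffD1])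
qed

lemma norm_vector_scalar_mult_complex:
  "norm (c *s (v :: complex ^ 'k::finite)) = norm c * norm v"
  by (simp add: norm_vec_def L2_set_def norm_mult power_mult_distrib
      real_sqrt_mult flip: sum_distrib_left)

text \<open>Gives access to one-variable theory: since the derivative of \<open>F\<close> commutes
  with complex scalars, its restriction to a complex line is multiplication by a complex
  number.\<close>

lemma holomorphic_several_on_line:
  assumes F: "holomorphic_several_on F U" and \<zeta>: "z + \<zeta> *s v \<in> U"
  shows "((\<lambda>\<zeta>. F (z + \<zeta> *s v)) has_field_derivative
    frechet_derivative F (at (z + \<zeta> *s v)) v) (at \<zeta>)"
proof -
  have "((\<lambda>\<zeta>. z + \<zeta> *s v) has_derivative (\<lambda>c. c *s v)) (at \<zeta>)"
    using bounded_linear_imp_has_derivative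
        [OF bounded_linear_vector_scalar_mult_left, of v "at \<zeta>"]
    by (auto intro!: derivative_eq_intros)
  from diff_chain_at [OF this holomorphic_several_has_derivative [OF F \<zeta>]]
  show ?thesis
    by (simp add: o_def has_field_derivative_def mult_commute_abs
        holomorphic_several_derivative_scale [OF F \<zeta>])
qed

text \<open>Cauchy's formula for the first derivative at 0 on the line through \<open>z\<close> in
  direction \<open>v\<close>. The right-hand side contains only values of \<open>F\<close>, so
  regularity in \<open>z\<close> can be read off from it.\<close>

lemma holomorphic_several_directional_Cauchy:
  assumes F: "holomorphic_several_on F U" and "0 < r"
    and disc: "\<And>\<zeta>. norm \<zeta> \<le> r \<Longrightarrow> z + \<zeta> *s v \<in> U"
  shows "frechet_derivative F (at z) v =
    integral (cbox 0 1) (\<lambda>t. F (z + circlepath 0 r t *s v) / circlepath 0 r t)"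
proof -
  let ?f = "\<lambda>\<zeta>. F (z + \<zeta> *s v)"
  have der: "(?f has_field_derivative frechet_derivative F (at (z + \<zeta> *s v)) v) (at \<zeta>)"
    if "norm \<zeta> \<le> r" for \<zeta>
    using holomorphic_several_on_line [OF F disc [OF that]] .
  have "continuous_on (cball 0 r) ?f"
    by (intro continuous_at_imp_continuous_on ballI)
       (use der [THEN DERIV_continuous] in simp)
  moreover have "?f holomorphic_on ball 0 r"
  proof (rule holomorphic_onI)
    show "?f field_differentiable at \<zeta> within ball 0 r" if "\<zeta> \<in> ball 0 r" for \<zeta>
      by (rule field_differentiable_at_within)
        (use der [of \<zeta>] that in \<open>auto simp: field_differentiable_def\<close>)
  qed
  ultimately have "(?f has_field_derivative
      1 / (2 * of_real pi * \<i>) * contour_integral (circlepath 0 r) (\<lambda>u. ?f u / (u - 0)\<^sup>2)) (at 0)"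
    by (rule Cauchy_derivative_integral_circlepath) (use \<open>0 < r\<close> in auto)
  then have "frechet_derivative F (at z) v =
      1 / (2 * of_real pi * \<i>) * contour_integral (circlepath 0 r) (\<lambda>u. ?f u / (u - 0)\<^sup>2)"
    using DERIV_unique [OF der [of 0]] \<open>0 < r\<close> by simp
  also have "\<dots> = integral (cbox 0 1) (\<lambda>t. 1 / (2 * of_real pi * \<i>) *
      (?f (circlepath 0 r t) / (circlepath 0 r t)\<^sup>2 * vector_derivative (circlepath 0 r) (at t)))"
    by (simp only: contour_integral_integral integral_mult_right cbox_interval diff_0_right)
  also have "\<dots> = integral (cbox 0 1) (\<lambda>t. ?f (circlepath 0 r t) / circlepath 0 r t)"
  proof (rule integral_cong)
    fix t :: real
    have "circlepath 0 r t \<noteq> 0"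
      using \<open>0 < r\<close> by (simp add: circlepath)
    \<comment> \<open>The velocity of the circle is \<open>2 * pi * \<i>\<close> times its position,
      which cancels the constant in front and one of the two factors in the denominator.\<close>
    moreover have "vector_derivative (circlepath 0 r) (at t) = 2 * of_real pi * \<i> * circlepath 0 r t"
      unfolding vector_derivative_circlepath by (simp add: circlepath)
    ultimately show "1 / (2 * of_real pi * \<i>) * (?f (circlepath 0 r t) / (circlepath 0 r t)\<^sup>2 *
        vector_derivative (circlepath 0 r) (at t)) = ?f (circlepath 0 r t) / circlepath 0 r t"
      by (simp add: power2_eq_square)
  qed
  finally show ?thesis .
qed

lemma continuous_on_circlepath: "continuous_on S (circlepath z r)"
  using has_vector_derivative_circlepath has_vector_derivative_continuous
  by (blast intro: continuous_at_imp_continuous_on)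

lemma holomorphic_several_continuous_on:
  "holomorphic_several_on F U \<Longrightarrow> continuous_on U F"
  by (auto intro!: continuous_at_imp_continuous_on
      dest!: holomorphic_several_has_derivative has_derivative_continuous)

text \<open>One radius serves for all centres in a ball, so that the centre can become the parameter
  of the integral.\<close>

lemma holomorphic_several_local_Cauchy:
  fixes F :: "complex ^ 'k::finite \<Rightarrow> complex"
  assumes F: "holomorphic_several_on F U" and "open U" "z0 \<in> U"
  obtains e r where "0 < e" "0 < r"
    "\<And>z t. z \<in> ball z0 e \<Longrightarrow> z + circlepath 0 r t *s v \<in> U"
    "\<And>z. z \<in> ball z0 e \<Longrightarrow> frechet_derivative F (at z) v =
      integral (cbox 0 1) (\<lambda>t. F (z + circlepath 0 r t *s v) / circlepath 0 r t)"
proof -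
  \<comment> \<open>Half of the radius \<open>2 * e\<close> is left for the centre \<open>z\<close>,
    the other half for the displacement along \<open>v\<close>.\<close>
  obtain e where e: "0 < e" "ball z0 (2 * e) \<subseteq> U"
    using assms(2,3) openE [of U z0] by (metis field_sum_of_halves mult_2 half_gt_zero)
  \<comment> \<open>The summand 1 keeps the denominator positive when \<open>v = 0\<close>.\<close>
  define r where "r = e / (norm v + 1)"
  have r: "0 < r" "r * norm v < e"
    using e(1) by (auto simp: r_def field_simps add_pos_nonneg)
  have U: "z + \<zeta> *s v \<in> U" if "z \<in> ball z0 e" "norm \<zeta> \<le> r" for z \<zeta>
  proof -
    have "norm (\<zeta> *s v) < e"
      using mult_right_mono [OF that(2) norm_ge_zero [of v]] r(2)
      by (simp add: norm_vector_scalar_mult_complex)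
    then have "dist z0 (z + \<zeta> *s v) < e + e"
      using that(1) by (intro dist_triangle_less_add [of _ z]) (auto simp: dist_norm)
    then show ?thesis
      using e(2) by auto
  qed
  have "z + circlepath 0 r t *s v \<in> U" if "z \<in> ball z0 e" for z t
    using that r(1) by (intro U) (auto simp: circlepath norm_mult norm_exp_eq_Re)
  then show ?thesis
    using that [OF e(1) r(1)] holomorphic_several_directional_Cauchy [OF F r(1)] U by blast
qed

section \<open>Cauchy integrals depending on a parameter\<close>

lemma continuous_on_circle_translate:
  "continuous_on (S \<times> T) (\<lambda>p. fst p + circlepath 0 r (snd p) *s (v :: complex ^ 'k::finite))"
proof -
  have "continuous_on (S \<times> T) (\<lambda>p. circlepath 0 r (snd p))"
    by (rule continuous_on_compose2 [OF continuous_on_circlepath [of UNIV]])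
      (auto intro: continuous_intros)
  then show ?thesis
    by (intro continuous_intros bounded_linear.continuous_on
        [OF bounded_linear_vector_scalar_mult_left])
qed

text \<open>Kept general in \<open>G\<close> because it is applied both to \<open>F\<close> and to
  the directional derivatives of \<open>F\<close>.\<close>

lemma continuous_on_circle_average_integrand:
  fixes G :: "complex ^ 'k::finite \<Rightarrow> complex"
  assumes G: "continuous_on U G" and r: "0 < r"
    and U: "\<And>z t. z \<in> B \<Longrightarrow> z + circlepath 0 r t *s v \<in> U"
  shows "continuous_on (B \<times> T) (\<lambda>(z, t). G (z + circlepath 0 r t *s v) / circlepath 0 r t)"
proof -
  have "continuous_on (B \<times> T) (\<lambda>p. G (fst p + circlepath 0 r (snd p) *s v))"
    by (rule continuous_on_compose2 [OF G continuous_on_circle_translate]) (use U in auto)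
  moreover have "continuous_on (B \<times> T) (\<lambda>p. circlepath 0 r (snd p))"
    by (rule continuous_on_compose2 [OF continuous_on_circlepath [of UNIV]])
      (auto intro: continuous_intros)
  ultimately show ?thesis
    using r by (auto simp: case_prod_unfold circlepath intro!: continuous_on_divide)
qed

text \<open>Near each point the directional derivative is an integral over a compact interval whose
  integrand is jointly continuous in the parameter and the variable of integration.\<close>

lemma holomorphic_several_derivative_continuous:
  fixes F :: "complex ^ 'k::finite \<Rightarrow> complex"
  assumes F: "holomorphic_several_on F U" and "open U"
  shows "continuous_on U (\<lambda>z. frechet_derivative F (at z) v)"
proof (rule continuous_at_imp_continuous_on, rule ballI)
  fix z0 assume "z0 \<in> U"
  obtain e r where er: "0 < e" "0 < r"
    and U: "\<And>z t. z \<in> ball z0 e \<Longrightarrow> z + circlepath 0 r t *s v \<in> U"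
    and eq: "\<And>z. z \<in> ball z0 e \<Longrightarrow> frechet_derivative F (at z) v =
      integral (cbox 0 1) (\<lambda>t. F (z + circlepath 0 r t *s v) / circlepath 0 r t)"
    by (rule holomorphic_several_local_Cauchy [OF F \<open>open U\<close> \<open>z0 \<in> U\<close>, of v]) (rule that)
  have "continuous_on (ball z0 e)
      (\<lambda>z. integral (cbox 0 1) (\<lambda>t. F (z + circlepath 0 r t *s v) / circlepath 0 r t))"
    by (intro integral_continuous_on_param continuous_on_circle_average_integrand
        [OF holomorphic_several_continuous_on [OF F] er(2) U])
  then have "continuous_on (ball z0 e) (\<lambda>z. frechet_derivative F (at z) v)"
    by (rule continuous_on_eq) (rule eq [symmetric])
  then show "isCont (\<lambda>z. frechet_derivative F (at z) v) z0"
    using er(1) by (simp add: continuous_on_eq_continuous_at)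
qed

text \<open>Differentiation under the Cauchy integral needs a continuous derivative of \<open>F\<close>. Holomorphy
  is defined by pointwise differentiability only, so the continuity is itself obtained from that integral.\<close>

lemma holomorphic_several_derivative:
  fixes F :: "complex ^ 'k::finite \<Rightarrow> complex"
  assumes F: "holomorphic_several_on F U" and "open U"
  shows "holomorphic_several_on (\<lambda>z. frechet_derivative F (at z) v) U"
  unfolding holomorphic_several_on_def
proof
  fix z0 assume "z0 \<in> U"
  obtain e r where er: "0 < e" "0 < r"
    and U: "\<And>z t. z \<in> ball z0 e \<Longrightarrow> z + circlepath 0 r t *s v \<in> U"
    and eq: "\<And>z. z \<in> ball z0 e \<Longrightarrow> frechet_derivative F (at z) v =
      integral (cbox 0 1) (\<lambda>t. F (z + circlepath 0 r t *s v) / circlepath 0 r t)"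
    by (rule holomorphic_several_local_Cauchy [OF F \<open>open U\<close> \<open>z0 \<in> U\<close>, of v]) (rule that)
  let ?B = "ball z0 e" and ?\<gamma> = "circlepath 0 r"
  \<comment> \<open>The derivative of the Cauchy integrand in \<open>z\<close>, packaged as a
    bounded linear operator because \<open>leibniz_rule\<close> integrates an operator-valued
    function.\<close>
  define L where "L z t = Blinfun (\<lambda>w. frechet_derivative F (at (z + ?\<gamma> t *s v)) w / ?\<gamma> t)" for z t
  have F': "(F has_derivative frechet_derivative F (at (z + ?\<gamma> t *s v))) (at (z + ?\<gamma> t *s v))"
    if "z \<in> ?B" for z t
    using holomorphic_several_has_derivative [OF F U [OF that]] .
  have L: "blinfun_apply (L z t) = (\<lambda>w. frechet_derivative F (at (z + ?\<gamma> t *s v)) w / ?\<gamma> t)"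
    if "z \<in> ?B" for z t
    unfolding L_def using has_derivative_bounded_linear [OF F' [OF that]]
    by (intro bounded_linear_Blinfun_apply bounded_linear_compose [OF bounded_linear_divide])
  have der: "((\<lambda>z. F (z + ?\<gamma> t *s v) / ?\<gamma> t) has_derivative L z t) (at z within ?B)"
    if "z \<in> ?B" for z t
  proof -
    have "((\<lambda>z. z + ?\<gamma> t *s v) has_derivative (\<lambda>w. w)) (at z)"
      by (auto intro!: derivative_eq_intros)
    from diff_chain_at [OF this F' [OF that]]
    have "((\<lambda>z. F (z + ?\<gamma> t *s v)) has_derivative frechet_derivative F (at (z + ?\<gamma> t *s v))) (at z)"
      by (simp add: o_def)
    from bounded_linear.has_derivative [OF bounded_linear_divide this, of "?\<gamma> t"]
    show ?thesis
      by (simp add: L [OF that] has_derivative_at_withinI)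
  qed
  have cont: "continuous_on (?B \<times> cbox 0 1) (\<lambda>(z, t). L z t)"
  \<comment> \<open>In finite dimension, continuity of an operator-valued map can be tested on each
    fixed vector.\<close>
  proof (rule continuous_on_blinfun_componentwise)
    fix w :: "complex ^ 'k"
    have "continuous_on (?B \<times> cbox 0 1)
        (\<lambda>(z, t). frechet_derivative F (at (z + ?\<gamma> t *s v)) w / ?\<gamma> t)"
      by (rule continuous_on_circle_average_integrand
          [OF holomorphic_several_derivative_continuous [OF F \<open>open U\<close>] er(2) U])
    then show "continuous_on (?B \<times> cbox 0 1) (\<lambda>p. blinfun_apply (case p of (z, t) \<Rightarrow> L z t) w)"
      by (rule continuous_on_eq) (auto simp: L)
  qed
  have z0: "z0 \<in> ?B"
    using er(1) by simp
  have slice: "continuous_on (cbox 0 1) (f z)"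
    if "continuous_on (?B \<times> cbox 0 1) (\<lambda>(z, t). f z t)" "z \<in> ?B"
    for f :: "complex ^ 'k \<Rightarrow> real \<Rightarrow> 'x::topological_space" and z
  proof -
    have "continuous_on (cbox 0 1) (\<lambda>t. (z, t))"
      by (intro continuous_on_Pair continuous_on_const continuous_on_id)
    from continuous_on_compose2 [OF that(1) this] show ?thesis
      using that(2) by (simp add: image_subset_iff)
  qed
  have int: "(\<lambda>t. F (z + ?\<gamma> t *s v) / ?\<gamma> t) integrable_on cbox 0 1" if "z \<in> ?B" for z
    by (intro integrable_continuous slice [OF _ that] continuous_on_circle_average_integrand
        [OF holomorphic_several_continuous_on [OF F] er(2) U])
  let ?I = "integral (cbox 0 1) (L z0)"
  have "((\<lambda>z. integral (cbox 0 1) (\<lambda>t. F (z + ?\<gamma> t *s v) / ?\<gamma> t)) has_derivative ?I)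
      (at z0 within ?B)"
    by (rule leibniz_rule [OF der int cont z0 convex_ball])
  then have "((\<lambda>z. frechet_derivative F (at z) v) has_derivative ?I) (at z0 within ?B)"
    by (rule has_derivative_transform [OF z0, rotated]) (rule eq)
  then have "((\<lambda>z. frechet_derivative F (at z) v) has_derivative ?I) (at z0)"
    unfolding at_within_open [OF z0 open_ball] .
  \<comment> \<open>Evaluation at a vector passes under the integral, and there every
    \<open>L z0 t\<close> is complex homogeneous.\<close>
  moreover have "blinfun_apply ?I (c *s w) = c * blinfun_apply ?I w" for c w
  proof -
    have "L z0 integrable_on cbox 0 1"
      by (rule integrable_continuous [OF slice [OF cont z0]])
    then have "blinfun_apply ?I u = integral (cbox 0 1) (\<lambda>t. blinfun_apply (L z0 t) u)" for u
      by (rule blinfun_apply_integral)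
    moreover have "blinfun_apply (L z0 t) (c *s w) = c * blinfun_apply (L z0 t) w" for t
      by (simp add: L [OF z0] holomorphic_several_derivative_scale [OF F U [OF z0]])
    ultimately show ?thesis
      by (simp only: integral_mult_right)
  qed
  ultimately show "\<exists>F'. ((\<lambda>z. frechet_derivative F (at z) v) has_derivative F') (at z0) \<and>
      (\<forall>c w. F' (c *s w) = c * F' w)"
    by blast
qed

text \<open>Directional derivatives of holomorphic functions are again holomorphic, so the induction
  on the order never leaves this class.\<close>

lemma holomorphic_several_smooth:
  fixes F :: "complex ^ 'k::finite \<Rightarrow> complex"
  assumes "holomorphic_several_on F U" "open U"
  shows "smooth_on U F"
proof -
  have "Ck_on n U F" for n
    using assms(1)
  proof (induction n arbitrary: F)
    case 0
    then show ?case by (simp add: holomorphic_several_continuous_on)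
  next
    case (Suc n)
    show ?case
      by (rule Ck_on_SucI [OF \<open>open U\<close> holomorphic_several_has_derivative [OF Suc.prems]])
        (auto intro: Suc holomorphic_several_derivative assms(2))
  qed
  then show ?thesis
    by (simp add: smooth_on_def)
qed

section \<open>Euler's relation for real-homogeneous holomorphic functions\<close>

lemma real_homogeneous_Euler:
  fixes F :: "complex ^ 'k::finite \<Rightarrow> complex" and d :: "'k \<Rightarrow> complex"
  assumes F: "holomorphic_several_on F U" and z: "z \<in> U"
    and N: "open N" "1 \<in> N"
    and hom: "\<And>t. (\<And>i. t i \<in> N) \<Longrightarrow> F (\<chi> i. complex_of_real (t i) * z $ i) =
      (\<Prod>i\<in>UNIV. complex_of_real (t i) powr d i) * F z"
  shows "z $ a * frechet_derivative F (at z) (axis a 1) = d a * F z"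
proof -
  \<comment> \<open>The path that multiplies the coordinate \<open>a\<close> of \<open>z\<close> by
    \<open>s\<close> and fixes the others. Its image under \<open>F\<close> is differentiated at
    \<open>s = 1\<close> in two ways.\<close>
  let ?p = "\<lambda>s. z + complex_of_real (s - 1) *s (z $ a *s axis a 1)"
  have eq: "F (?p s) = complex_of_real s powr d a * F z" if "s \<in> N" for s
  proof -
    \<comment> \<open>The other factors stay at 1, which lies in \<open>N\<close>, and their powers
      drop out of the product.\<close>
    let ?t = "\<lambda>i. if i = a then s else 1"
    have "?p s = (\<chi> i. complex_of_real (?t i) * z $ i)"
      by (simp add: vec_eq_iff axis_def left_diff_distrib)
    moreover have "(\<Prod>i\<in>UNIV. complex_of_real (?t i) powr d i) = complex_of_real s powr d a"
    proof -
      have "(\<Prod>i\<in>UNIV. complex_of_real (?t i) powr d i) =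
          (\<Prod>i\<in>UNIV. if i = a then complex_of_real s powr d i else 1)"
        by (intro prod.cong) auto
      then show ?thesis by simp
    qed
    ultimately show ?thesis
      using hom [of ?t] that N(2) by simp
  qed
  have "((\<lambda>\<zeta>. F (z + \<zeta> *s (z $ a *s axis a 1))) has_field_derivative
      frechet_derivative F (at (z + 0 *s (z $ a *s axis a 1))) (z $ a *s axis a 1)) (at 0)"
    by (rule holomorphic_several_on_line [OF F]) (use z in simp)
  \<comment> \<open>The base point 0 is written as \<open>complex_of_real 1 - 1\<close>, the value
    at 1 of the inner map of the chain rule that follows.\<close>
  then have "((\<lambda>\<zeta>. F (z + \<zeta> *s (z $ a *s axis a 1))) has_field_derivative
      z $ a * frechet_derivative F (at z) (axis a 1)) (at (complex_of_real 1 - 1))"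
    by (simp add: holomorphic_several_derivative_scale [OF F z] del: vector_smult_assoc)
  moreover have "((\<lambda>s. s - 1) has_field_derivative 1) (at (complex_of_real 1))"
    by (auto intro!: derivative_eq_intros)
  ultimately have "((\<lambda>s. F (z + (s - 1) *s (z $ a *s axis a 1))) has_field_derivative
      z $ a * frechet_derivative F (at z) (axis a 1) * 1) (at (complex_of_real 1))"
    by (rule DERIV_chain2)
  from has_vector_derivative_real_field [OF this]
  have "((\<lambda>s. F (?p s)) has_vector_derivative z $ a * frechet_derivative F (at z) (axis a 1)) (at 1)"
    by simp
  \<comment> \<open>The homogeneity formula holds for \<open>s\<close> in the open set
    \<open>N\<close> around 1, which suffices for the derivative at 1.\<close>
  moreover have "((\<lambda>s. F (?p s)) has_vector_derivative d a * F z) (at 1)"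
  proof (rule has_vector_derivative_transform_within_open [OF _ N(1,2)])
    have "((\<lambda>s. s powr d a * F z) has_field_derivative d a * F z) (at (complex_of_real 1))"
      by (auto intro!: derivative_eq_intros)
    from has_vector_derivative_real_field [OF this]
    show "((\<lambda>s. complex_of_real s powr d a * F z) has_vector_derivative d a * F z) (at 1)" .
  qed (rule eq [symmetric])
  ultimately show ?thesis
    by (rule vector_derivative_unique_at)
qed

section \<open>Charts and the metric\<close>

lemma differentiable_det:
  fixes A :: "'a::real_normed_vector \<Rightarrow> real ^ 'm ^ 'm::finite"
  assumes "\<And>i j. (\<lambda>x. A x $ i $ j) differentiable at x"
  shows "(\<lambda>x. det (A x)) differentiable at x"
proof -
  have prod: "(\<lambda>x. \<Prod>i\<in>I. A x $ i $ p i) differentiable at x" for I and p :: "'m \<Rightarrow> 'm"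
    using assms by (induction I rule: infinite_finite_induct) auto
  show ?thesis
    unfolding det_def by (auto intro!: differentiable_sum differentiable_mult prod)
qed

lemma matrix_mult_matrix_inv:
  fixes A :: "real ^ 'm ^ 'm::finite"
  assumes "invertible A"
  shows "A ** matrix_inv A = mat 1"
  using someI_ex [OF assms [unfolded invertible_def]] by (simp add: matrix_inv_def)

text \<open>Cramer's rule for the system whose solution is column \<open>j\<close> of the inverse.
  It makes the entries rational in those of \<open>A\<close>, which reduces their differentiability
  to that of determinants.\<close>

lemma matrix_inv_entry:
  fixes A :: "real ^ 'm ^ 'm::finite"
  assumes "invertible A"
  shows "matrix_inv A $ i $ j = det (\<chi> k l. if l = i then axis j 1 $ k else A $ k $ l) / det A"
proof -
  have "A *v (matrix_inv A *v axis j 1) = axis j 1"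
    by (simp add: matrix_vector_mul_assoc matrix_mult_matrix_inv [OF assms])
  then have "matrix_inv A *v axis j 1 =
      (\<chi> i. det (\<chi> k l. if l = i then axis j 1 $ k else A $ k $ l) / det A)"
    using cramer [of A] assms by (simp add: invertible_det_nz)
  then show ?thesis
    by (simp add: matrix_vector_mult_basis column_def vec_eq_iff)
qed

text \<open>When \<open>A\<close> is the metric matrix, these are the coefficients of the
  Laplace-Beltrami operator in divergence form.\<close>

lemma differentiable_sqrt_det_matrix_inv:
  fixes A :: "'a::real_normed_vector \<Rightarrow> real ^ 'm ^ 'm::finite"
  assumes A: "A differentiable at x" and S: "open S" "x \<in> S"
    and inv: "\<And>y. y \<in> S \<Longrightarrow> invertible (A y)"
  shows "(\<lambda>y. sqrt (det (A y)) * matrix_inv (A y) $ i $ j) differentiable at x"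
proof -
  have entry: "(\<lambda>y. A y $ k $ l) differentiable at x" for k l
    by (rule differentiable_compose [OF bounded_linear_imp_differentiable
          [OF bounded_linear_compose [OF bounded_linear_vec_nth bounded_linear_vec_nth]] A])
  have det: "(\<lambda>y. det (A y)) differentiable at x" and "det (A x) \<noteq> 0"
    using inv [OF S(2)] by (auto intro: differentiable_det entry simp: invertible_det_nz)
  \<comment> \<open>On negative numbers \<open>sqrt x = - sqrt (- x)\<close>, so it is differentiable at every nonzero point
    and the sign of the determinant does not matter.\<close>
  have "(sqrt has_real_derivative (if 0 < det (A x) then inverse (sqrt (det (A x))) / 2
      else - inverse (sqrt (det (A x))) / 2)) (at (det (A x)))"
    by (rule DERIV_real_sqrt_generic) (use \<open>det (A x) \<noteq> 0\<close> in auto)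
  then have "sqrt differentiable at (det (A x))"
    by (rule differentiableI [OF has_field_derivative_imp_has_derivative])
  then have sqrt: "(\<lambda>y. sqrt (det (A y))) differentiable at x"
    using det by (rule differentiable_compose)
  have "(\<lambda>y. (\<chi> k l. if l = i then axis j 1 $ k else A y $ k $ l) $ k $ l) differentiable at x" for k l
    by (cases "l = i") (auto intro: entry)
  then have "(\<lambda>y. det (\<chi> k l. if l = i then axis j 1 $ k else A y $ k $ l) / det (A y))
      differentiable at x"
    by (intro differentiable_divide differentiable_det det) (use \<open>det (A x) \<noteq> 0\<close> in auto)
  with sqrt have "(\<lambda>y. sqrt (det (A y)) *
      (det (\<chi> k l. if l = i then axis j 1 $ k else A y $ k $ l) / det (A y))) differentiable at x"
    by (rule differentiable_mult)
  then show ?thesis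
    by (rule differentiable_cong_open [OF S, rotated]) (simp add: matrix_inv_entry inv)
qed

lemma bounded_linear_axis: "bounded_linear (axis i :: 'b::euclidean_space \<Rightarrow> 'b ^ 'k::finite)"
proof -
  have "linear (axis i :: 'b \<Rightarrow> 'b ^ 'k)"
    by (rule linearI) (auto simp: vec_eq_iff axis_def)
  then show ?thesis
    by (rule linear_conv_bounded_linear [THEN iffD1])
qed

section \<open>Smooth functions read in charts\<close>

context smooth_manifold
begin

lemma cdom_subset: "c \<in> Atl \<Longrightarrow> cdom c \<subseteq> topspace X"
  using charts_cover by blast

lemma inj_on_coord: "c \<in> Atl \<Longrightarrow> inj_on (coord c) (cdom c)"
  by (metis homeomorphic_imp_injective_map chart_homeo cdom_subset topspace_subtopology_subset)

lemma param_coord: "c \<in> Atl \<Longrightarrow> p \<in> cdom c \<Longrightarrow> param c (coord c p) = p"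
  by (simp add: param_def inj_on_coord)

lemma open_coord_image:
  assumes "c \<in> Atl" "openin X V"
  shows "open (coord c ` (cdom c \<inter> V))"
proof -
  have "openin (subtopology X (cdom c)) (cdom c \<inter> V)"
    using assms(2) by (rule openin_subtopology_Int2)
  then have "openin (top_of_set (coord c ` cdom c)) (coord c ` (cdom c \<inter> V))"
    using homeomorphic_imp_open_map [OF chart_homeo [OF assms(1)]] by (simp add: open_map_def)
  then show ?thesis
    using chart_image_open [OF assms(1)] openin_open_eq by blast
qed

text \<open>Smoothness is a condition on coordinate representations, so openness is shown in each
  chart domain and then passes to the union over the covering charts.\<close>

lemma openin_smooth_preimage:
  assumes f: "smooth_fun_on X Atl V f" and "open W"
  shows "openin X {p \<in> V. f p \<in> W}"
proof -
  have V: "openin X V"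
    using f by (simp add: smooth_fun_on_def)
  have "openin X {p \<in> cdom c \<inter> V. f p \<in> W}" if c: "c \<in> Atl" for c
  proof -
    let ?T = "coord c ` (cdom c \<inter> V)"
    have "continuous_on ?T (f \<circ> param c)"
      using f c Ck_on.simps(1) unfolding smooth_fun_on_def smooth_on_def by blast
    then have "open (?T \<inter> (f \<circ> param c) -` W)"
      using open_coord_image [OF c V] \<open>open W\<close> by (rule continuous_open_preimage)
    then have "openin (top_of_set (coord c ` cdom c)) (?T \<inter> (f \<circ> param c) -` W)"
      by (auto simp: openin_open_eq [OF chart_image_open [OF c]])
    then have "openin (subtopology X (cdom c))
        {p \<in> topspace (subtopology X (cdom c)). coord c p \<in> ?T \<inter> (f \<circ> param c) -` W}"
      using homeomorphic_imp_continuous_map [OF chart_homeo [OF c]]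
      unfolding continuous_map_def by blast
    moreover have "{p \<in> topspace (subtopology X (cdom c)). coord c p \<in> ?T \<inter> (f \<circ> param c) -` W}
        = {p \<in> cdom c \<inter> V. f p \<in> W}"
      using cdom_subset [OF c] inj_on_coord [OF c]
      by (auto simp: param_coord [OF c] dest: inj_onD)
    ultimately show ?thesis
      using openin_trans_full chart_open [OF c] by simp
  qed
  then have "openin X (\<Union>c\<in>Atl. {p \<in> cdom c \<inter> V. f p \<in> W})"
    by blast
  also have "(\<Union>c\<in>Atl. {p \<in> cdom c \<inter> V. f p \<in> W}) = {p \<in> V. f p \<in> W}"
    using openin_subset [OF V] charts_cover by blast
  finally show ?thesis .
qed

lemma smooth_fun_on_compose:
  fixes f :: "'a \<Rightarrow> 'e::euclidean_space" and h :: "'e \<Rightarrow> 'b::real_normed_vector"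
  assumes f: "smooth_fun_on X Atl V f" and W: "open W" and h: "smooth_on W h"
  shows "smooth_fun_on X Atl {p \<in> V. f p \<in> W} (\<lambda>p. h (f p))"
  unfolding smooth_fun_on_def smooth_on_def
proof (intro conjI ballI allI)
  let ?V = "{p \<in> V. f p \<in> W}"
  show V: "openin X ?V"
    by (rule openin_smooth_preimage [OF f W])
  fix c n assume c: "c \<in> Atl"
  have "Ck_on n (coord c ` (cdom c \<inter> ?V)) (\<lambda>x. h ((f \<circ> param c) x))"
  proof (rule Ck_on_compose [OF open_coord_image [OF c V]])
    show "Ck_on n W h"
      using h by (simp add: smooth_on_def)
    have "Ck_on n (coord c ` (cdom c \<inter> V)) (f \<circ> param c)"
      using f c by (simp add: smooth_fun_on_def smooth_on_def)
    then show "Ck_on n (coord c ` (cdom c \<inter> ?V)) (f \<circ> param c)"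
      by (rule Ck_on_subset) auto
    show "(f \<circ> param c) ` coord c ` (cdom c \<inter> ?V) \<subseteq> W"
      by (auto simp: param_coord [OF c])
  qed
  then show "Ck_on n (coord c ` (cdom c \<inter> ?V)) ((\<lambda>p. h (f p)) \<circ> param c)"
    by (simp add: o_def)
qed

lemma smooth_fun_on_vec:
  fixes f :: "'k::finite \<Rightarrow> 'a \<Rightarrow> complex"
  assumes "openin X V" "\<And>i. smooth_fun_on X Atl V (f i)"
  shows "smooth_fun_on X Atl V (\<lambda>p. \<chi> i. f i p)"
  unfolding smooth_fun_on_def smooth_on_def
proof (intro conjI ballI allI)
  show "openin X V" by fact
  fix c n assume c: "c \<in> Atl"
  have "Ck_on n (coord c ` (cdom c \<inter> V)) (f i \<circ> param c)" for i
    using assms(2) c by (simp add: smooth_fun_on_def smooth_on_def)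
  \<comment> \<open>Writing the vector as a sum of \<open>axis\<close> images of its components
    reduces the claim to closure under sums and bounded linear maps.\<close>
  then have "Ck_on n (coord c ` (cdom c \<inter> V)) (\<lambda>x. \<Sum>i\<in>UNIV. axis i ((f i \<circ> param c) x))"
    by (intro Ck_on_sum open_coord_image [OF c \<open>openin X V\<close>] bounded_linear.Ck_on [OF bounded_linear_axis])
  also have "(\<lambda>x. \<Sum>i\<in>UNIV. axis i ((f i \<circ> param c) x)) = (\<lambda>p. \<chi> i. f i p) \<circ> param c"
    by (auto simp: fun_eq_iff vec_eq_iff axis_def if_distrib cong: if_cong)
  finally show "Ck_on n (coord c ` (cdom c \<inter> V)) ((\<lambda>p. \<chi> i. f i p) \<circ> param c)" .
qed

lemma smooth_fun_on_has_derivative: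
  assumes f: "smooth_fun_on X Atl V f" and "c \<in> Atl" "p \<in> cdom c" "p \<in> V"
  shows "((f \<circ> param c) has_derivative frechet_derivative (f \<circ> param c) (at (coord c p)))
    (at (coord c p))"
proof -
  have "Ck_on (Suc 0) (coord c ` (cdom c \<inter> V)) (f \<circ> param c)"
    using assms unfolding smooth_fun_on_def smooth_on_def by blast
  then show ?thesis
    by (rule Ck_on_has_derivative) (use assms in blast)
qed

lemma pdiff_differentiable:
  assumes f: "smooth_fun_on X Atl V f" and c: "c \<in> Atl" "p \<in> cdom c" "p \<in> V"
  shows "(pdiff c j f \<circ> param c) differentiable at (coord c p)"
proof -
  have V: "openin X V"
    using f by (simp add: smooth_fun_on_def)
  have "Ck_on (Suc (Suc 0)) (coord c ` (cdom c \<inter> V)) (f \<circ> param c)"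
    using assms unfolding smooth_fun_on_def smooth_on_def by blast
  then have "(\<lambda>x. frechet_derivative (f \<circ> param c) (at x) (axis j 1)) differentiable at (coord c p)"
    using c by auto
  then show ?thesis
    by (rule differentiable_cong_open [OF open_coord_image [OF c(1) V], rotated 2])
      (use c in \<open>auto simp: pdiff_def param_coord\<close>)
qed

end

section \<open>The metric and the gradient in a chart\<close>

context riemannian_manifold
begin

lemma metric_invertible:
  assumes "c \<in> Atl" "p \<in> cdom c"
  shows "invertible (g c p)"
proof -
  have "v = 0" if "g c p *v v = 0" for v
    using metric_positive [OF assms, of v] that by auto
  then show ?thesis
    by (simp add: invertible_left_inverse matrix_left_invertible_ker)
qed

lemma metric_entry_symmetric:
  assumes "c \<in> Atl" "p \<in> cdom c"
  shows "g c p $ i $ j = g c p $ j $ i"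
  using arg_cong [OF metric_symmetric [OF assms], of "\<lambda>A. A $ j $ i"]
  by (simp add: transpose_def)

text \<open>Lowering the index cancels the inverse matrix in \<open>grad\<close>; symmetry of the
  metric brings the sum into the form of a matrix product.\<close>

lemma metric_lower_grad:
  assumes "c \<in> Atl" "p \<in> cdom c"
  shows "(\<Sum>i\<in>UNIV. complex_of_real (g c p $ i $ j) * grad g c f p $ i) = pdiff c j f p"
proof -
  have inv: "(\<Sum>i\<in>UNIV. g c p $ j $ i * matrix_inv (g c p) $ i $ l) = mat 1 $ j $ l" for l
    using arg_cong [OF matrix_mult_matrix_inv [OF metric_invertible [OF assms]], of "\<lambda>A. A $ j $ l"]
    by (simp add: matrix_matrix_mult_def)
  have "(\<Sum>i\<in>UNIV. complex_of_real (g c p $ i $ j) * grad g c f p $ i) =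
      (\<Sum>i\<in>UNIV. \<Sum>l\<in>UNIV. complex_of_real (g c p $ j $ i * matrix_inv (g c p) $ i $ l) * pdiff c l f p)"
    by (simp add: grad_def sum_distrib_left mult.assoc metric_entry_symmetric [OF assms, of _ j])
  also have "\<dots> = (\<Sum>l\<in>UNIV. complex_of_real (\<Sum>i\<in>UNIV. g c p $ j $ i * matrix_inv (g c p) $ i $ l)
      * pdiff c l f p)"
    by (subst sum.swap) (simp add: sum_distrib_right)
  also have "\<dots> = (\<Sum>l\<in>UNIV. if j = l then pdiff c l f p else 0)"
    by (intro sum.cong) (auto simp: inv mat_def simp del: of_real_sum)
  finally show ?thesis by simp
qed

text \<open>The defining property of the gradient: pairing with it is applying the differential of
  \<open>f\<close>.\<close>

lemma metric_bilinear_grad: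
  assumes "c \<in> Atl" "p \<in> cdom c"
  shows "metric_bilinear g c p (grad g c f p) w = (\<Sum>j\<in>UNIV. pdiff c j f p * w $ j)"
proof -
  have "metric_bilinear g c p (grad g c f p) w =
      (\<Sum>j\<in>UNIV. (\<Sum>i\<in>UNIV. complex_of_real (g c p $ i $ j) * grad g c f p $ i) * w $ j)"
    unfolding metric_bilinear_def by (subst sum.swap) (simp add: sum_distrib_right)
  then show ?thesis
    by (simp add: metric_lower_grad [OF assms])
qed

lemma metric_bilinear_commute:
  assumes "c \<in> Atl" "p \<in> cdom c"
  shows "metric_bilinear g c p v w = metric_bilinear g c p w v"
  unfolding metric_bilinear_def
  by (subst sum.swap, intro sum.cong refl)
    (simp add: mult_ac metric_entry_symmetric [OF assms])

end

section \<open>Chain rules for the Laplace-Beltrami and conformality operators\<close>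

text \<open>The imaginary part vanishes near \<open>x\<close>, so its derivative is 0 by
  uniqueness.\<close>

lemma frechet_derivative_in_Reals:
  fixes f :: "'b::real_normed_vector \<Rightarrow> complex"
  assumes "open S" "x \<in> S" "\<And>y. y \<in> S \<Longrightarrow> f y \<in> \<real>" "f differentiable at x"
  shows "frechet_derivative f (at x) v \<in> \<real>"
proof -
  have "((\<lambda>y. Im (f y)) has_derivative (\<lambda>v. Im (frechet_derivative f (at x) v))) (at x)"
    using assms(4) bounded_linear.has_derivative [OF bounded_linear_Im]
    by (simp add: frechet_derivative_works)
  then have "((\<lambda>y. 0) has_derivative (\<lambda>v. Im (frechet_derivative f (at x) v))) (at x)"
    by (rule has_derivative_transform_within_open [OF _ assms(1,2)])
      (simp add: assms(3) complex_is_Real_iff [symmetric])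
  then have "(\<lambda>v. Im (frechet_derivative f (at x) v)) = (\<lambda>v. 0)"
    by (rule has_derivative_unique) simp
  then show ?thesis
    by (simp add: complex_is_Real_iff fun_eq_iff)
qed

section \<open>Partial derivatives in a chart\<close>

context smooth_manifold
begin

lemma smooth_fun_on_subset:
  assumes "smooth_fun_on X Atl V f" "openin X V'" "V' \<subseteq> V"
  shows "smooth_fun_on X Atl V' f"
  using assms Ck_on_subset [of _ "coord _ ` (cdom _ \<inter> V)" _ "coord _ ` (cdom _ \<inter> V')"]
  unfolding smooth_fun_on_def smooth_on_def by (meson Int_mono image_mono order_refl)

lemma smooth_fun_on_bounded_linear:
  assumes "smooth_fun_on X Atl V f" "bounded_linear L"
  shows "smooth_fun_on X Atl V (\<lambda>p. L (f p))"
  using assms open_coord_image bounded_linear.Ck_on [OF assms(2)]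
  unfolding smooth_fun_on_def smooth_on_def o_def by blast

lemma pdiff_cong_open:
  assumes "c \<in> Atl" "openin X V" "p \<in> cdom c" "p \<in> V" "\<And>q. q \<in> cdom c \<inter> V \<Longrightarrow> f q = h q"
  shows "pdiff c i f p = pdiff c i h p"
  unfolding pdiff_def
  by (subst frechet_derivative_cong_open [OF open_coord_image [OF assms(1,2)], of _ _ "h \<circ> param c"])
    (use assms in \<open>auto simp: param_coord\<close>)

lemma pdiff_in_Reals:
  assumes "c \<in> Atl" "openin X V" "p \<in> cdom c" "p \<in> V" "\<And>q. q \<in> cdom c \<inter> V \<Longrightarrow> f q \<in> \<real>"
    and "(f \<circ> param c) differentiable at (coord c p)"
  shows "pdiff c i f p \<in> \<real>"
  unfolding pdiff_def
  by (rule frechet_derivative_in_Reals [OF open_coord_image [OF assms(1,2)]])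
    (use assms in \<open>auto simp: param_coord\<close>)

lemma pdiff_sum_mult:
  fixes P Y :: "'n::finite \<Rightarrow> 'a \<Rightarrow> complex"
  assumes c: "c \<in> Atl" "p \<in> cdom c"
    and P: "\<And>a. (P a \<circ> param c) differentiable at (coord c p)"
    and Y: "\<And>a. (Y a \<circ> param c) differentiable at (coord c p)"
  shows "pdiff c i (\<lambda>q. \<Sum>a\<in>UNIV. P a q * Y a q) p =
    (\<Sum>a\<in>UNIV. P a p * pdiff c i (Y a) p + pdiff c i (P a) p * Y a p)"
proof -
  have "((\<lambda>x. \<Sum>a\<in>UNIV. (P a \<circ> param c) x * (Y a \<circ> param c) x) has_derivative
      (\<lambda>v. \<Sum>a\<in>UNIV. (P a \<circ> param c) (coord c p) * frechet_derivative (Y a \<circ> param c) (at (coord c p)) v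
        + frechet_derivative (P a \<circ> param c) (at (coord c p)) v * (Y a \<circ> param c) (coord c p)))
      (at (coord c p))"
    by (intro has_derivative_sum has_derivative_mult) (use P Y frechet_derivative_works in blast)+
  from frechet_derivative_eq [OF this] show ?thesis
    by (simp add: pdiff_def o_def param_coord [OF c])
qed

lemma chart_at:
  assumes "p \<in> topspace X"
  shows "chart_at Atl p \<in> Atl" "p \<in> cdom (chart_at Atl p)"
proof -
  have "\<exists>c. c \<in> Atl \<and> p \<in> cdom c"
    using assms charts_cover by blast
  from someI_ex [OF this] show "chart_at Atl p \<in> Atl" "p \<in> cdom (chart_at Atl p)"
    by (simp_all add: chart_at_def)
qed

end

section \<open>The operators on functions of finitely many functions\<close>

context riemannian_manifold
begin

abbreviation density :: "('a, 'm) chart \<Rightarrow> 'a \<Rightarrow> complex" where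
  "density c q \<equiv> complex_of_real (sqrt (det (g c q)))"

lemma differentiable_density_grad:
  assumes u: "smooth_fun_on X Atl V u" and c: "c \<in> Atl" "p \<in> cdom c" "p \<in> V"
  shows "((\<lambda>q. density c q * grad g c u q $ i) \<circ> param c) differentiable at (coord c p)"
proof -
  have V: "openin X V"
    using u by (simp add: smooth_fun_on_def)
  have "Ck_on (Suc 0) (coord c ` cdom c) (g c \<circ> param c)"
    using metric_smooth [OF c(1)] unfolding smooth_on_def by blast
  then have "(g c \<circ> param c) differentiable at (coord c p)"
    using c(2) by simp
  then have "(\<lambda>x. sqrt (det ((g c \<circ> param c) x)) * matrix_inv ((g c \<circ> param c) x) $ i $ j)
      differentiable at (coord c p)" for j
    by (rule differentiable_sqrt_det_matrix_inv [OF _ chart_image_open [OF c(1)]])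
      (use c in \<open>auto simp: param_coord metric_invertible\<close>)
  then have w: "(\<lambda>x. complex_of_real (sqrt (det ((g c \<circ> param c) x)) *
      matrix_inv ((g c \<circ> param c) x) $ i $ j)) differentiable at (coord c p)" for j
    by (rule differentiable_compose
        [OF bounded_linear_imp_differentiable [OF bounded_linear_of_real]])
  have "(\<lambda>x. \<Sum>j\<in>UNIV. complex_of_real (sqrt (det ((g c \<circ> param c) x)) *
      matrix_inv ((g c \<circ> param c) x) $ i $ j) * (pdiff c j u \<circ> param c) x)
      differentiable at (coord c p)"
    by (intro differentiable_sum ballI differentiable_mult w pdiff_differentiable [OF u c]) auto
  also have "(\<lambda>x. \<Sum>j\<in>UNIV. complex_of_real (sqrt (det ((g c \<circ> param c) x)) *
      matrix_inv ((g c \<circ> param c) x) $ i $ j) * (pdiff c j u \<circ> param c) x) =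
      (\<lambda>q. density c q * grad g c u q $ i) \<circ> param c"
    by (simp add: fun_eq_iff grad_def sum_distrib_left mult.assoc)
  finally show ?thesis .
qed

lemma density_nonzero: "c \<in> Atl \<Longrightarrow> p \<in> cdom c \<Longrightarrow> density c p \<noteq> 0"
  using metric_invertible by (simp add: invertible_det_nz)

text \<open>At a fixed point the gradient is linear in the partial derivatives, so a chain rule for
  these carries over.\<close>

lemma grad_chain:
  fixes u :: "'n::finite \<Rightarrow> 'a \<Rightarrow> complex"
  assumes "\<And>j. pdiff c j f q = (\<Sum>a\<in>UNIV. P a * pdiff c j (u a) q)"
  shows "grad g c f q $ i = (\<Sum>a\<in>UNIV. P a * grad g c (u a) q $ i)"
proof -
  have "grad g c f q $ i = (\<Sum>j\<in>UNIV. \<Sum>a\<in>UNIV. P a *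
      (complex_of_real (matrix_inv (g c q) $ i $ j) * pdiff c j (u a) q))"
    by (simp add: grad_def assms sum_distrib_left mult.left_commute)
  also have "\<dots> = (\<Sum>a\<in>UNIV. P a * grad g c (u a) q $ i)"
    by (subst sum.swap) (simp add: grad_def sum_distrib_left)
  finally show ?thesis .
qed

text \<open>Stated for coefficient functions \<open>P a\<close> instead of derivatives of an outer function, so that it
  applies both to holomorphic functions of \<open>u\<close> and to real functions of the real and imaginary parts.\<close>

lemma laplace_beltrami_chain:
  fixes u :: "'n::finite \<Rightarrow> 'a \<Rightarrow> complex"
  assumes V: "openin X V" "p \<in> V"
    and u: "\<And>a. smooth_fun_on X Atl V (u a)"
    and f: "\<And>c q j. c \<in> Atl \<Longrightarrow> q \<in> cdom c \<Longrightarrow> q \<in> V \<Longrightarrow>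
      pdiff c j f q = (\<Sum>a\<in>UNIV. P a q * pdiff c j (u a) q)"
    and P: "\<And>c a. c \<in> Atl \<Longrightarrow> p \<in> cdom c \<Longrightarrow> (P a \<circ> param c) differentiable at (coord c p)"
    and Q: "\<And>c a i. c \<in> Atl \<Longrightarrow> p \<in> cdom c \<Longrightarrow>
      pdiff c i (P a) p = (\<Sum>b\<in>UNIV. Q a b * pdiff c i (u b) p)"
  shows "laplace_beltrami Atl g f p = (\<Sum>a\<in>UNIV. P a p * laplace_beltrami Atl g (u a) p)
    + (\<Sum>a\<in>UNIV. \<Sum>b\<in>UNIV. Q a b * conformality Atl g (u b) (u a) p)"
proof -
  define c where "c = chart_at Atl p"
  have p: "p \<in> topspace X"
    using V openin_subset by blast
  have c: "c \<in> Atl" "p \<in> cdom c"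
    using chart_at [OF p] by (simp_all add: c_def)
  let ?s = "density c p" and ?Y = "\<lambda>a i q. density c q * grad g c (u a) q $ i"
  have s: "?s \<noteq> 0"
    by (rule density_nonzero [OF c])
  \<comment> \<open>The product rule is applied with the density kept next to the gradient of
    \<open>u a\<close>: the first summands then form a divergence, and in the second ones the
    density cancels.\<close>
  have "pdiff c i (\<lambda>q. density c q * grad g c f q $ i) p =
      (\<Sum>a\<in>UNIV. P a p * pdiff c i (?Y a i) p + pdiff c i (P a) p * ?Y a i p)" for i
  proof -
    have "pdiff c i (\<lambda>q. density c q * grad g c f q $ i) p =
        pdiff c i (\<lambda>q. \<Sum>a\<in>UNIV. P a q * ?Y a i q) p"
    proof (rule pdiff_cong_open [OF c(1) V(1) c(2) V(2)])
      fix q assume "q \<in> cdom c \<inter> V"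
      then have "grad g c f q $ i = (\<Sum>a\<in>UNIV. P a q * grad g c (u a) q $ i)"
        by (intro grad_chain f c) auto
      then show "density c q * grad g c f q $ i = (\<Sum>a\<in>UNIV. P a q * ?Y a i q)"
        by (simp add: sum_distrib_left mult.left_commute)
    qed
    also have "\<dots> = (\<Sum>a\<in>UNIV. P a p * pdiff c i (?Y a i) p + pdiff c i (P a) p * ?Y a i p)"
      by (rule pdiff_sum_mult [OF c P [OF c] differentiable_density_grad [OF u c V(2)]])
    finally show ?thesis .
  qed
  then have "laplace_beltrami Atl g f p =
      (\<Sum>i\<in>UNIV. \<Sum>a\<in>UNIV. P a p * pdiff c i (?Y a i) p + pdiff c i (P a) p * ?Y a i p) / ?s"
    by (simp add: laplace_beltrami_def divergence_def Let_def flip: c_def)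
  also have "\<dots> = (\<Sum>a\<in>UNIV. \<Sum>i\<in>UNIV. P a p * pdiff c i (?Y a i) p / ?s
      + pdiff c i (P a) p * grad g c (u a) p $ i)"
    using s by (subst sum.swap) (simp add: sum_divide_distrib add_divide_distrib)
  also have "\<dots> = (\<Sum>a\<in>UNIV. P a p * laplace_beltrami Atl g (u a) p)
      + (\<Sum>a\<in>UNIV. \<Sum>i\<in>UNIV. pdiff c i (P a) p * grad g c (u a) p $ i)"
    by (simp add: laplace_beltrami_def divergence_def Let_def sum.distrib sum_distrib_left
        sum_divide_distrib flip: c_def)
  \<comment> \<open>The differential of \<open>P a\<close> applied to the gradient of
    \<open>u a\<close>; expanding that differential by \<open>Q\<close> produces the conformality
    terms.\<close>
  also have "(\<lambda>a. \<Sum>i\<in>UNIV. pdiff c i (P a) p * grad g c (u a) p $ i) =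
      (\<lambda>a. \<Sum>b\<in>UNIV. Q a b * conformality Atl g (u b) (u a) p)"
  proof
    fix a
    have "(\<Sum>i\<in>UNIV. pdiff c i (P a) p * grad g c (u a) p $ i) =
        (\<Sum>i\<in>UNIV. \<Sum>b\<in>UNIV. Q a b * (pdiff c i (u b) p * grad g c (u a) p $ i))"
      by (simp add: Q [OF c] sum_distrib_right mult.assoc)
    also have "\<dots> = (\<Sum>b\<in>UNIV. Q a b * conformality Atl g (u b) (u a) p)"
      by (subst sum.swap)
        (simp add: conformality_def Let_def metric_bilinear_grad [OF c] sum_distrib_left flip: c_def)
    finally show "(\<Sum>i\<in>UNIV. pdiff c i (P a) p * grad g c (u a) p $ i) =
        (\<Sum>b\<in>UNIV. Q a b * conformality Atl g (u b) (u a) p)" .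
  qed
  finally show ?thesis .
qed

lemma conformality_chain:
  fixes u :: "'n::finite \<Rightarrow> 'a \<Rightarrow> complex"
  assumes p: "p \<in> topspace X"
    and f: "\<And>c j. c \<in> Atl \<Longrightarrow> p \<in> cdom c \<Longrightarrow>
      pdiff c j f p = (\<Sum>a\<in>UNIV. P a * pdiff c j (u a) p)"
  shows "conformality Atl g f f p =
    (\<Sum>a\<in>UNIV. \<Sum>b\<in>UNIV. P a * P b * conformality Atl g (u a) (u b) p)"
proof -
  define c where "c = chart_at Atl p"
  have c: "c \<in> Atl" "p \<in> cdom c"
    using chart_at [OF p] by (simp_all add: c_def)
  have "conformality Atl g f f p = (\<Sum>j\<in>UNIV. pdiff c j f p * grad g c f p $ j)"
    by (simp add: conformality_def Let_def metric_bilinear_grad [OF c] flip: c_def)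
  also have "\<dots> = (\<Sum>j\<in>UNIV. \<Sum>a\<in>UNIV. \<Sum>b\<in>UNIV.
      P a * P b * (pdiff c j (u a) p * grad g c (u b) p $ j))"
    by (simp add: f [OF c] grad_chain [OF f [OF c]] sum_product mult_ac)
  also have "\<dots> = (\<Sum>a\<in>UNIV. \<Sum>b\<in>UNIV. \<Sum>j\<in>UNIV.
      P a * P b * (pdiff c j (u a) p * grad g c (u b) p $ j))"
    by (subst sum.swap, intro sum.cong refl, rule sum.swap)
  also have "\<dots> = (\<Sum>a\<in>UNIV. \<Sum>b\<in>UNIV. P a * P b * conformality Atl g (u a) (u b) p)"
    by (simp add: conformality_def Let_def metric_bilinear_grad [OF c] sum_distrib_left flip: c_def)
  finally show ?thesis .
qed

lemma conformality_commute:
  assumes "p \<in> topspace X"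
  shows "conformality Atl g f h p = conformality Atl g h f p"
  unfolding conformality_def Let_def
  by (rule metric_bilinear_commute [OF chart_at [OF assms]])

lemma grad_in_Reals:
  assumes "\<And>j. pdiff c j u q \<in> \<real>"
  shows "grad g c u q $ i \<in> \<real>"
  using assms by (simp add: grad_def)

text \<open>Metric and density are real, hence so is everything built from a real function. This
  later splits complex equations into real and imaginary parts.\<close>

lemma real_valued_operators:
  assumes V: "openin X V" "p \<in> V"
    and u: "smooth_fun_on X Atl V u" "\<And>q. q \<in> V \<Longrightarrow> u q \<in> \<real>"
    and v: "smooth_fun_on X Atl V v" "\<And>q. q \<in> V \<Longrightarrow> v q \<in> \<real>"
  shows "laplace_beltrami Atl g u p \<in> \<real>" and "conformality Atl g u v p \<in> \<real>"
proof -
  define c where "c = chart_at Atl p"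
  have p: "p \<in> topspace X"
    using V openin_subset by blast
  have c: "c \<in> Atl" "p \<in> cdom c"
    using chart_at [OF p] by (simp_all add: c_def)
  have pdiff: "pdiff c j w q \<in> \<real>"
    if "smooth_fun_on X Atl V w" "\<And>q. q \<in> V \<Longrightarrow> w q \<in> \<real>" "q \<in> cdom c" "q \<in> V" for w q j
    using that smooth_fun_on_has_derivative [OF that(1) c(1) that(3,4)]
    by (intro pdiff_in_Reals [OF c(1) V(1)]) (auto intro: differentiableI)
  have "pdiff c i (\<lambda>q. density c q * grad g c u q $ i) p \<in> \<real>" for i
    by (rule pdiff_in_Reals [OF c(1) V(1) c(2) V(2) _ differentiable_density_grad [OF u(1) c V(2)]])
      (auto intro!: Reals_mult grad_in_Reals pdiff u)
  then show "laplace_beltrami Atl g u p \<in> \<real>"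
    by (simp add: laplace_beltrami_def divergence_def Let_def flip: c_def)
  show "conformality Atl g u v p \<in> \<real>"
    by (auto simp: conformality_def Let_def metric_bilinear_grad [OF c] simp flip: c_def
        intro!: sum_in_Reals Reals_mult grad_in_Reals pdiff u v c V)
qed

end

section \<open>Eigenfunctions\<close>

lemma real_homogeneous_Euler_second:
  fixes F :: "complex ^ 'k::finite \<Rightarrow> complex" and d :: "'k \<Rightarrow> complex"
  assumes F: "holomorphic_several_on F U" and U: "open U" "z \<in> U"
    and Euler: "\<And>z a. z \<in> U \<Longrightarrow> z $ a * frechet_derivative F (at z) (axis a 1) = d a * F z"
  shows "z $ a * z $ b *
      frechet_derivative (\<lambda>z. frechet_derivative F (at z) (axis a 1)) (at z) (axis b 1) =
    d a * d b * F z - (if a = b then d a * F z else 0)"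
proof -
  let ?G = "\<lambda>z. frechet_derivative F (at z) (axis a 1)"
  have G: "(?G has_derivative frechet_derivative ?G (at z)) (at z)"
    by (rule holomorphic_several_has_derivative [OF holomorphic_several_derivative [OF F U(1)] U(2)])
  have "((\<lambda>z. z $ a * ?G z) has_derivative
      (\<lambda>v. z $ a * frechet_derivative ?G (at z) v + v $ a * ?G z)) (at z)"
    by (rule has_derivative_mult [OF bounded_linear_imp_has_derivative [OF bounded_linear_vec_nth] G])
  \<comment> \<open>Euler's relation is an identity on the open set \<open>U\<close>, so both sides
    have the same derivative at \<open>z\<close>; the product rule on the left gives the Kronecker
    term.\<close>
  moreover have "((\<lambda>z. z $ a * ?G z) has_derivative (\<lambda>v. d a * frechet_derivative F (at z) v)) (at z)"
    by (rule has_derivative_transform_within_open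
        [OF has_derivative_mult_right [OF holomorphic_several_has_derivative [OF F U(2)]] U])
      (simp add: Euler)
  ultimately have "(\<lambda>v. z $ a * frechet_derivative ?G (at z) v + v $ a * ?G z) =
      (\<lambda>v. d a * frechet_derivative F (at z) v)"
    by (rule has_derivative_unique)
  then have "z $ a * frechet_derivative ?G (at z) (axis b 1) + (axis b 1 :: complex ^ 'k) $ a * ?G z =
      d a * frechet_derivative F (at z) (axis b 1)"
    by (rule fun_cong)
  \<comment> \<open>The factor \<open>z $ b\<close> makes Euler's relation applicable once more, to
    both remaining first derivatives.\<close>
  from arg_cong [OF this, of "\<lambda>x. z $ b * x"]
  have "z $ b * (z $ a * frechet_derivative ?G (at z) (axis b 1)) =
      d a * (z $ b * frechet_derivative F (at z) (axis b 1)) -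
      (axis b 1 :: complex ^ 'k) $ a * (z $ b * ?G z)"
    by (simp add: algebra_simps)
  then show ?thesis
    using Euler [OF U(2), of a] Euler [OF U(2), of b]
    by (auto simp: axis_def mult_ac)
qed

section \<open>Partial derivatives of composite functions\<close>

context smooth_manifold
begin

lemma holomorphic_compose_has_derivative:
  fixes F :: "complex ^ 'k::finite \<Rightarrow> complex"
  assumes F: "holomorphic_several_on F U" and f: "\<And>i. smooth_fun_on X Atl V (f i)"
    and c: "c \<in> Atl" "p \<in> cdom c" "p \<in> V" and U: "(\<chi> i. f i p) \<in> U"
  shows "((\<lambda>x. F (\<chi> i. f i (param c x))) has_derivative
      (\<lambda>v. \<Sum>a\<in>UNIV. frechet_derivative F (at (\<chi> i. f i p)) (axis a 1) *
        frechet_derivative (f a \<circ> param c) (at (coord c p)) v)) (at (coord c p))"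
proof -
  let ?z = "\<chi> i. f i p"
  let ?D = "\<lambda>a. frechet_derivative (f a \<circ> param c) (at (coord c p))"
  have "((\<lambda>x. \<Sum>a\<in>UNIV. axis a ((f a \<circ> param c) x)) has_derivative
      (\<lambda>v. \<Sum>a\<in>UNIV. axis a (?D a v))) (at (coord c p))"
    by (intro has_derivative_sum bounded_linear.has_derivative [OF bounded_linear_axis]
        smooth_fun_on_has_derivative [OF f c])
  moreover have axis: "(\<Sum>a\<in>UNIV. axis a (w a)) = (\<chi> a. w a)" for w :: "'k \<Rightarrow> complex"
    by (simp add: vec_eq_iff axis_def if_distrib cong: if_cong)
  ultimately have "((\<lambda>x. \<chi> a. f a (param c x)) has_derivative (\<lambda>v. \<chi> a. ?D a v)) (at (coord c p))"
    by simp
  moreover have "(F has_derivative frechet_derivative F (at ?z)) (at (\<chi> a. f a (param c (coord c p))))"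
    using holomorphic_several_has_derivative [OF F U] by (simp add: param_coord [OF c(1,2)])
  ultimately have "((\<lambda>x. F (\<chi> a. f a (param c x))) has_derivative
      (\<lambda>v. frechet_derivative F (at ?z) (\<chi> a. ?D a v))) (at (coord c p))"
    using diff_chain_at [unfolded o_def] by blast
  \<comment> \<open>Complex linearity lets the complex coefficients \<open>w a\<close> come out, so
    the directions \<open>axis a 1\<close> alone suffice and no conjugate derivatives
    appear.\<close>
  moreover have "frechet_derivative F (at ?z) (\<chi> a. w a) =
      (\<Sum>a\<in>UNIV. frechet_derivative F (at ?z) (axis a 1) * w a)" for w
  proof -
    have "frechet_derivative F (at ?z) (\<Sum>a\<in>UNIV. w a *s axis a 1) =
        (\<Sum>a\<in>UNIV. frechet_derivative F (at ?z) (w a *s axis a 1))"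
      by (rule linear_sum [OF has_derivative_linear [OF holomorphic_several_has_derivative [OF F U]]])
    moreover have "(\<Sum>a\<in>UNIV. w a *s axis a 1) = (\<chi> a. w a)"
      using basis_expansion [of "\<chi> a. w a"] by simp
    ultimately show ?thesis
      by (simp add: holomorphic_several_derivative_scale [OF F U] mult.commute)
  qed
  ultimately show ?thesis
    by simp
qed

lemma pdiff_holomorphic_compose:
  fixes F :: "complex ^ 'k::finite \<Rightarrow> complex"
  assumes "holomorphic_several_on F U" "\<And>i. smooth_fun_on X Atl V (f i)"
    and c: "c \<in> Atl" "p \<in> cdom c" "p \<in> V" and "(\<chi> i. f i p) \<in> U"
  shows "pdiff c j (\<lambda>q. F (\<chi> i. f i q)) p =
    (\<Sum>a\<in>UNIV. frechet_derivative F (at (\<chi> i. f i p)) (axis a 1) * pdiff c j (f a) p)"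
  using frechet_derivative_eq [OF holomorphic_compose_has_derivative [OF assms]]
  by (simp add: pdiff_def o_def)

lemma real_compose_has_derivative:
  fixes k :: "complex \<Rightarrow> real"
  assumes f: "smooth_fun_on X Atl V f" and c: "c \<in> Atl" "p \<in> cdom c" "p \<in> V"
    and k: "(k has_derivative k') (at (f p))"
  shows "((\<lambda>x. complex_of_real (k (f (param c x)))) has_derivative
      (\<lambda>v. complex_of_real (k' (frechet_derivative (f \<circ> param c) (at (coord c p)) v)))) (at (coord c p))"
proof -
  have "(k has_derivative k') (at ((f \<circ> param c) (coord c p)))"
    using k by (simp add: param_coord [OF c(1,2)])
  from diff_chain_at [OF smooth_fun_on_has_derivative [OF f c] this]
  show ?thesis
    by (intro bounded_linear.has_derivative [OF bounded_linear_of_real]) (simp add: o_def)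
qed

lemma pdiff_real_compose:
  fixes k :: "complex \<Rightarrow> real"
  assumes "smooth_fun_on X Atl V f" "c \<in> Atl" "p \<in> cdom c" "p \<in> V"
    and "(k has_derivative k') (at (f p))"
  shows "pdiff c j (\<lambda>q. complex_of_real (k (f q))) p = complex_of_real (k' (pdiff c j f p))"
  using frechet_derivative_eq [OF real_compose_has_derivative [OF assms]]
  by (simp add: pdiff_def o_def)

lemma pdiff_Re_Im:
  assumes "smooth_fun_on X Atl V f" "c \<in> Atl" "p \<in> cdom c" "p \<in> V"
  shows "pdiff c j (\<lambda>q. complex_of_real (Re (f q))) p = complex_of_real (Re (pdiff c j f p))"
    and "pdiff c j (\<lambda>q. complex_of_real (Im (f q))) p = complex_of_real (Im (pdiff c j f p))"
  by (rule pdiff_real_compose [OF assms bounded_linear_imp_has_derivative [OF bounded_linear_Re]],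
      rule pdiff_real_compose [OF assms bounded_linear_imp_has_derivative [OF bounded_linear_Im]])

end

lemma complex_real_linear_expansion:
  fixes L :: "complex \<Rightarrow> real"
  assumes "linear L"
  shows "L w = Re w * L 1 + Im w * L \<i>"
proof -
  have "L (Re w *\<^sub>R 1 + Im w *\<^sub>R \<i>) = Re w * L 1 + Im w * L \<i>"
    by (simp only: linear_add [OF assms] linear_scale [OF assms] real_scaleR_def)
  moreover have "Re w *\<^sub>R 1 + Im w *\<^sub>R \<i> = w"
    by (simp add: complex_eq_iff)
  ultimately show ?thesis by simp
qed

section \<open>Real and imaginary parts, and harmonic morphisms\<close>

context riemannian_manifold
begin

text \<open>Real and imaginary part as a family indexed by \<open>bool\<close>, to fit the chain
  rules for finite families; the values are complex because the operators act on complex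
  functions.\<close>

definition re_im :: "('a \<Rightarrow> complex) \<Rightarrow> bool \<Rightarrow> 'a \<Rightarrow> complex" where
  "re_im f b q = complex_of_real (if b then Re (f q) else Im (f q))"

lemma re_im_simps:
  "re_im f True = (\<lambda>q. complex_of_real (Re (f q)))"
  "re_im f False = (\<lambda>q. complex_of_real (Im (f q)))"
  by (auto simp: re_im_def)

lemma smooth_re_im:
  assumes "smooth_fun_on X Atl V f"
  shows "smooth_fun_on X Atl V (re_im f b)"
  using smooth_fun_on_bounded_linear
      [OF assms bounded_linear_compose [OF bounded_linear_of_real bounded_linear_Re]]
    smooth_fun_on_bounded_linear
      [OF assms bounded_linear_compose [OF bounded_linear_of_real bounded_linear_Im]]
  by (cases b) (simp_all add: re_im_simps)

lemma re_im_of_00_eigenfunction: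
  assumes f: "eigenfunction_on X Atl g V 0 0 f" and p: "p \<in> V"
  shows "laplace_beltrami Atl g (re_im f b) p = 0"
    and "conformality Atl g (re_im f True) (re_im f True) p =
      conformality Atl g (re_im f False) (re_im f False) p"
    and "conformality Atl g (re_im f True) (re_im f False) p = 0"
    and "conformality Atl g (re_im f False) (re_im f True) p = 0"
proof -
  have sm: "smooth_fun_on X Atl V f" and V: "openin X V"
    and LB: "laplace_beltrami Atl g f p = 0" and K: "conformality Atl g f f p = 0"
    using f p by (auto simp: eigenfunction_on_def smooth_fun_on_def)
  have X: "p \<in> topspace X"
    using V p openin_subset by blast
  let ?P = "\<lambda>b::bool. if b then 1 else \<i>"
  have f_pdiff: "pdiff c j f q = (\<Sum>b\<in>UNIV. ?P b * pdiff c j (re_im f b) q)"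
    if "c \<in> Atl" "q \<in> cdom c" "q \<in> V" for c q j
    using complex_eq [of "pdiff c j f q"]
    by (simp add: UNIV_bool re_im_simps pdiff_Re_Im [OF sm that] add.commute)
  let ?L = "\<lambda>b. laplace_beltrami Atl g (re_im f b) p"
  let ?K = "\<lambda>a b. conformality Atl g (re_im f a) (re_im f b) p"
  have real: "?L b \<in> \<real>" "?K a b \<in> \<real>" for a b
    by (rule real_valued_operators [OF V p smooth_re_im [OF sm] _ smooth_re_im [OF sm]]; simp add: re_im_def)+
  \<comment> \<open>The coefficients 1 and \<open>\<i>\<close> are constant, so the second-order
    coefficients are 0.\<close>
  have "laplace_beltrami Atl g f p = (\<Sum>b\<in>UNIV. ?P b * ?L b)
      + (\<Sum>a\<in>UNIV. \<Sum>b\<in>UNIV. 0 * ?K b a)"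
    by (rule laplace_beltrami_chain [OF V p smooth_re_im [OF sm] f_pdiff])
      (simp_all add: o_def pdiff_def)
  then have "?L True + \<i> * ?L False = 0"
    using LB by (simp add: UNIV_bool add.commute)
  with real(1) [of True] real(1) [of False] show "?L b = 0"
    by (cases b) (auto elim!: Reals_cases simp: complex_eq_iff)
  have "conformality Atl g f f p = (\<Sum>a\<in>UNIV. \<Sum>b\<in>UNIV. ?P a * ?P b * ?K a b)"
    by (rule conformality_chain [OF X f_pdiff [OF _ _ p]])
  then have "?K True True - ?K False False + 2 * \<i> * ?K True False = 0"
    using K conformality_commute [OF X, of "re_im f False" "re_im f True"]
    by (simp add: UNIV_bool algebra_simps)
  \<comment> \<open>All three numbers are real, so the complex equation is two real ones.\<close>
  with real(2) [of True True] real(2) [of False False] real(2) [of True False]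
  show "?K True True = ?K False False" "?K True False = 0"
    by (auto elim!: Reals_cases simp: complex_eq_iff)
  then show "?K False True = 0"
    using conformality_commute [OF X] by metis
qed

lemma eigenfunction_00_imp_harmonic_morphism:
  assumes f: "eigenfunction_on X Atl g V 0 0 f"
  shows "harmonic_morphism_on X Atl g V f"
  unfolding harmonic_morphism_on_def harmonic_on_def
proof (intro conjI allI impI ballI)
  show sm: "smooth_fun_on X Atl V f"
    using f by (simp add: eigenfunction_on_def)
  fix W and h :: "complex \<Rightarrow> real" assume h: "plane_harmonic_on W h"
  then have W: "open W" and h_smooth: "smooth_on W h"
    by (simp_all add: plane_harmonic_on_def)
  let ?V = "{p \<in> V. f p \<in> W}"
  have "smooth_on W (\<lambda>z. complex_of_real (h z))"
    using h_smooth unfolding smooth_on_def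
    by (intro allI bounded_linear.Ck_on [OF bounded_linear_of_real W]) blast
  with sm W show "smooth_fun_on X Atl ?V (\<lambda>p. complex_of_real (h (f p)))"
    by (rule smooth_fun_on_compose)
  fix p assume p: "p \<in> ?V"
  have V: "openin X ?V"
    by (rule openin_smooth_preimage [OF sm W])
  have smV: "smooth_fun_on X Atl ?V f"
    by (rule smooth_fun_on_subset [OF sm V]) auto
  \<comment> \<open>The directions 1 and \<open>\<i>\<close> match the indices of
    \<open>re_im\<close>, so \<open>?D\<close> lists the two partial derivatives of
    \<open>h\<close>.\<close>
  let ?e = "\<lambda>b::bool. if b then 1 else \<i>"
  let ?D = "\<lambda>b z. frechet_derivative h (at z) (?e b)"
  have "Ck_on (Suc (Suc 0)) W h"
    using h_smooth unfolding smooth_on_def by blast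
  then have C2: "Ck_on (Suc 0) W h" "Ck_on (Suc 0) W (?D b)" for b
    by (rule Ck_on_SucD) (use \<open>Ck_on (Suc (Suc 0)) W h\<close> Ck_on.simps(2) in blast)
  \<comment> \<open>Stated for any \<open>k\<close> of class C^1 because it serves \<open>h\<close>
    itself and then its partial derivatives \<open>?D b\<close>.\<close>
  have chain: "pdiff c j (\<lambda>q. complex_of_real (k (f q))) q =
      (\<Sum>b\<in>UNIV. complex_of_real (frechet_derivative k (at (f q)) (?e b)) * pdiff c j (re_im f b) q)"
    if "Ck_on (Suc 0) W k" "c \<in> Atl" "q \<in> cdom c" "q \<in> ?V" for k c j q
  proof -
    have k: "(k has_derivative frechet_derivative k (at (f q))) (at (f q))"
      by (rule Ck_on_has_derivative [OF that(1)]) (use that in auto)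
    show ?thesis
      using complex_real_linear_expansion [OF has_derivative_linear [OF k], of "pdiff c j f q"]
      by (simp add: pdiff_real_compose [OF smV that(2-4) k] UNIV_bool re_im_simps
          pdiff_Re_Im [OF smV that(2-4)] mult.commute add.commute)
  qed
  have "laplace_beltrami Atl g (\<lambda>q. complex_of_real (h (f q))) p =
      (\<Sum>a\<in>UNIV. complex_of_real (?D a (f p)) * laplace_beltrami Atl g (re_im f a) p)
      + (\<Sum>a\<in>UNIV. \<Sum>b\<in>UNIV. complex_of_real (frechet_derivative (?D a) (at (f p)) (?e b)) *
          conformality Atl g (re_im f b) (re_im f a) p)"
  proof (rule laplace_beltrami_chain [OF V p smooth_re_im [OF smV] chain [OF C2(1)] _ chain [OF C2(2) _ _ p]])
    fix c a assume c: "c \<in> Atl" "p \<in> cdom c"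
    have k: "(?D a has_derivative frechet_derivative (?D a) (at (f p))) (at (f p))"
      by (rule Ck_on_has_derivative [OF C2(2)]) (use p in auto)
    show "((\<lambda>q. complex_of_real (?D a (f q))) \<circ> param c) differentiable at (coord c p)"
      using real_compose_has_derivative [OF smV c p k] by (auto simp: o_def intro: differentiableI)
  qed
  \<comment> \<open>The first-order and mixed terms vanish, and both diagonal terms carry the same
    conformality factor; what remains in front is the plane Laplacian of \<open>h\<close>.\<close>
  also have "\<dots> = complex_of_real (\<Sum>a\<in>UNIV. frechet_derivative (?D a) (at (f p)) (?e a)) *
      conformality Atl g (re_im f True) (re_im f True) p"
    using re_im_of_00_eigenfunction [OF f] p by (simp add: UNIV_bool algebra_simps)
  also have "(\<Sum>a\<in>UNIV. frechet_derivative (?D a) (at (f p)) (?e a)) = 0"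
    using h p by (simp add: plane_harmonic_on_def UNIV_bool add.commute)
  finally show "laplace_beltrami Atl g (\<lambda>p. complex_of_real (h (f p))) p = 0"
    by simp
qed

text \<open>The eigenfamily equations supply for every derivative of \<open>F\<close> the matching
  coordinates \<open>z $ a\<close>, and Euler's relations turn these products into multiples of
  \<open>F\<close>.\<close>

lemma real_homogeneous_eigenfunction:
  fixes F :: "complex ^ 'k::finite \<Rightarrow> complex" and d :: "'k \<Rightarrow> complex"
  assumes \<phi>: "eigenfamily_on X Atl g (topspace X) lam A \<phi>"
    and U: "open U" and F: "holomorphic_several_on F U"
    and Euler: "\<And>z a. z \<in> U \<Longrightarrow> z $ a * frechet_derivative F (at z) (axis a 1) = d a * F z"
  shows "eigenfunction_on X Atl g {p \<in> topspace X. (\<chi> i. \<phi> i p) \<in> U}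
    ((\<Sum>i\<in>UNIV. d i * (lam i - A i i)) + (\<Sum>i\<in>UNIV. \<Sum>j\<in>UNIV. d i * d j * A i j))
    (\<Sum>i\<in>UNIV. \<Sum>j\<in>UNIV. d i * d j * A i j)
    (\<lambda>p. F (\<chi> i. \<phi> i p))"
  unfolding eigenfunction_on_def
proof (intro conjI ballI)
  let ?V = "{p \<in> topspace X. (\<chi> i. \<phi> i p) \<in> U}"
  have sm: "smooth_fun_on X Atl (topspace X) (\<phi> i)" for i
    using \<phi> by (simp add: eigenfamily_on_def)
  have sm_vec: "smooth_fun_on X Atl (topspace X) (\<lambda>p. \<chi> i. \<phi> i p)"
    by (rule smooth_fun_on_vec [OF openin_topspace sm])
  have V: "openin X ?V"
    by (rule openin_smooth_preimage [OF sm_vec U])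
  show "smooth_fun_on X Atl ?V (\<lambda>p. F (\<chi> i. \<phi> i p))"
    by (rule smooth_fun_on_compose [OF sm_vec U holomorphic_several_smooth [OF F U]])
  have smV: "smooth_fun_on X Atl ?V (\<phi> i)" for i
    by (rule smooth_fun_on_subset [OF sm V]) auto
  let ?D = "\<lambda>a z. frechet_derivative F (at z) (axis a 1)"
  have D: "holomorphic_several_on (?D a) U" for a
    by (rule holomorphic_several_derivative [OF F U])
  fix p assume p: "p \<in> ?V"
  define z where "z = (\<chi> i. \<phi> i p)"
  have z: "z \<in> U" "\<And>i. \<phi> i p = z $ i"
    using p by (auto simp: z_def)
  let ?Q = "\<lambda>a b. frechet_derivative (?D a) (at z) (axis b 1)"
  have "laplace_beltrami Atl g (\<lambda>p. F (\<chi> i. \<phi> i p)) p =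
      (\<Sum>a\<in>UNIV. ?D a (\<chi> i. \<phi> i p) * laplace_beltrami Atl g (\<phi> a) p)
      + (\<Sum>a\<in>UNIV. \<Sum>b\<in>UNIV. ?Q a b * conformality Atl g (\<phi> b) (\<phi> a) p)"
  proof (rule laplace_beltrami_chain [OF V p smV])
    show "pdiff c j (\<lambda>p. F (\<chi> i. \<phi> i p)) q = (\<Sum>a\<in>UNIV. ?D a (\<chi> i. \<phi> i q) * pdiff c j (\<phi> a) q)"
      if "c \<in> Atl" "q \<in> cdom c" "q \<in> ?V" for c q j
      by (rule pdiff_holomorphic_compose [where f = \<phi>, OF F smV that]) (use that in auto)
    show "((\<lambda>q. ?D a (\<chi> i. \<phi> i q)) \<circ> param c) differentiable at (coord c p)"
      if "c \<in> Atl" "p \<in> cdom c" for c a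
      using holomorphic_compose_has_derivative [where f = \<phi>, OF D [of a] smV that p] p
      by (auto simp: o_def intro: differentiableI)
    show "pdiff c i (\<lambda>q. ?D a (\<chi> i. \<phi> i q)) p = (\<Sum>b\<in>UNIV. ?Q a b * pdiff c i (\<phi> b) p)"
      if "c \<in> Atl" "p \<in> cdom c" for c a i
      unfolding z_def by (rule pdiff_holomorphic_compose [where f = \<phi>, OF D smV that p]) (use p in auto)
  qed
  also have "\<dots> = (\<Sum>a\<in>UNIV. lam a * (z $ a * ?D a z))
      + (\<Sum>a\<in>UNIV. \<Sum>b\<in>UNIV. A b a * (z $ a * z $ b * ?Q a b))"
    using \<phi> p by (simp add: eigenfamily_on_def z(2) mult_ac flip: z_def)
  also have "\<dots> = (\<Sum>a\<in>UNIV. lam a * (d a * F z))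
      + (\<Sum>a\<in>UNIV. \<Sum>b\<in>UNIV. A b a * (d a * d b * F z - (if a = b then d a * F z else 0)))"
    by (simp only: Euler [OF z(1)] real_homogeneous_Euler_second [OF F U z(1) Euler])
  \<comment> \<open>The Kronecker term selects the diagonal entries \<open>A a a\<close>, which then
    combine with \<open>lam a\<close>.\<close>
  also have "\<dots> = (\<Sum>a\<in>UNIV. lam a * (d a * F z))
      + (\<Sum>a\<in>UNIV. \<Sum>b\<in>UNIV. d a * d b * A b a * F z - (if a = b then d a * A a a * F z else 0))"
    by (intro arg_cong2 [where f = "(+)"] refl sum.cong) (simp add: algebra_simps)
  also have "\<dots> = (\<Sum>a\<in>UNIV. d a * (lam a - A a a)) * F z
      + (\<Sum>a\<in>UNIV. \<Sum>b\<in>UNIV. d a * d b * A b a) * F z"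
    by (simp add: sum_subtractf sum_distrib_left algebra_simps)
  \<comment> \<open>The chain rule produced \<open>A\<close> with transposed indices; exchanging the
    two sums restores their order.\<close>
  also have "(\<Sum>a\<in>UNIV. \<Sum>b\<in>UNIV. d a * d b * A b a) = (\<Sum>i\<in>UNIV. \<Sum>j\<in>UNIV. d i * d j * A i j)"
    by (subst sum.swap) (simp add: mult_ac)
  finally show "laplace_beltrami Atl g (\<lambda>p. F (\<chi> i. \<phi> i p)) p =
      ((\<Sum>i\<in>UNIV. d i * (lam i - A i i)) + (\<Sum>i\<in>UNIV. \<Sum>j\<in>UNIV. d i * d j * A i j)) *
      F (\<chi> i. \<phi> i p)"
    by (simp add: distrib_right flip: z_def)
  have "conformality Atl g (\<lambda>p. F (\<chi> i. \<phi> i p)) (\<lambda>p. F (\<chi> i. \<phi> i p)) p =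
      (\<Sum>a\<in>UNIV. \<Sum>b\<in>UNIV. ?D a z * ?D b z * conformality Atl g (\<phi> a) (\<phi> b) p)"
    unfolding z_def
    by (intro conformality_chain pdiff_holomorphic_compose [where f = \<phi>, OF F smV _ _ p]) (use p in auto)
  also have "\<dots> = (\<Sum>a\<in>UNIV. \<Sum>b\<in>UNIV. A a b * (z $ a * ?D a z) * (z $ b * ?D b z))"
    using \<phi> p by (simp add: eigenfamily_on_def z(2) mult_ac)
  also have "\<dots> = (\<Sum>i\<in>UNIV. \<Sum>j\<in>UNIV. d i * d j * A i j) * (F z)\<^sup>2"
    by (simp only: Euler [OF z(1)]) (simp add: sum_distrib_left power2_eq_square mult_ac)
  finally show "conformality Atl g (\<lambda>p. F (\<chi> i. \<phi> i p)) (\<lambda>p. F (\<chi> i. \<phi> i p)) p =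
      (\<Sum>i\<in>UNIV. \<Sum>j\<in>UNIV. d i * d j * A i j) * (F (\<chi> i. \<phi> i p))\<^sup>2"
    by (simp add: z_def)
qed

end

theorem theorem1p5:
  fixes X :: "'a topology" and Atl :: "('a, 'm::finite) chart set"
    and g :: "('a, 'm) chart \<Rightarrow> 'a \<Rightarrow> real ^ 'm ^ 'm"
    and \<phi> :: "'k::finite \<Rightarrow> 'a \<Rightarrow> complex"
    and lam :: "'k \<Rightarrow> complex" and A :: "'k \<Rightarrow> 'k \<Rightarrow> complex" and d :: "'k \<Rightarrow> complex"
    and U :: "(complex ^ 'k) set" and F :: "complex ^ 'k \<Rightarrow> complex"
  assumes "riemannian_manifold X Atl g"
    and "eigenfamily_on X Atl g (topspace X) lam A \<phi>"
    and "open U"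
    and "holomorphic_several_on F U"
    and "\<forall>z\<in>U. \<exists>N. open N \<and> 1 \<in> N \<and> N \<subseteq> {0<..} \<and>
           (\<forall>t::'k \<Rightarrow> real. (\<forall>i. t i \<in> N) \<longrightarrow>
              (\<chi> i. complex_of_real (t i) * z $ i) \<in> U \<and>
              F (\<chi> i. complex_of_real (t i) * z $ i)
                = (\<Prod>i\<in>UNIV. complex_of_real (t i) powr d i) * F z)"
  shows "eigenfunction_on X Atl g {p \<in> topspace X. (\<chi> i. \<phi> i p) \<in> U}
           ((\<Sum>i\<in>UNIV. d i * (lam i - A i i)) + (\<Sum>i\<in>UNIV. \<Sum>j\<in>UNIV. d i * d j * A i j))
           (\<Sum>i\<in>UNIV. \<Sum>j\<in>UNIV. d i * d j * A i j)
           (\<lambda>p. F (\<chi> i. \<phi> i p)) \<and>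
        ((\<Sum>i\<in>UNIV. \<Sum>j\<in>UNIV. d i * d j * A i j) = 0 \<and>
         (\<Sum>i\<in>UNIV. d i * (lam i - A i i)) = 0 \<longrightarrow>
         harmonic_morphism_on X Atl g {p \<in> topspace X. (\<chi> i. \<phi> i p) \<in> U}
           (\<lambda>p. F (\<chi> i. \<phi> i p)))"
proof -
  interpret riemannian_manifold X Atl g by fact
  have Euler: "z $ a * frechet_derivative F (at z) (axis a 1) = d a * F z" if z: "z \<in> U" for z a
  proof -
    obtain N where N: "open N" "1 \<in> N" and hom: "\<And>t. (\<And>i. t i \<in> N) \<Longrightarrow>
        F (\<chi> i. complex_of_real (t i) * z $ i) = (\<Prod>i\<in>UNIV. complex_of_real (t i) powr d i) * F z"
      using bspec [OF assms(5) z] by auto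
    show ?thesis
      by (rule real_homogeneous_Euler [OF assms(4) z N hom])
  qed
  note eigen = real_homogeneous_eigenfunction [OF assms(2-4) Euler]
  show ?thesis
  proof (intro conjI impI)
    \<comment> \<open>Under these equations both parameters of the eigenfunction become 0.\<close>
    assume "(\<Sum>i\<in>UNIV. \<Sum>j\<in>UNIV. d i * d j * A i j) = 0 \<and> (\<Sum>i\<in>UNIV. d i * (lam i - A i i)) = 0"
    with eigen show "harmonic_morphism_on X Atl g {p \<in> topspace X. (\<chi> i. \<phi> i p) \<in> U}
        (\<lambda>p. F (\<chi> i. \<phi> i p))"
      by (intro eigenfunction_00_imp_harmonic_morphism) simp
  qed (rule eigen)
qed

end
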